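(* Let $K$ be a field and $E$ a row-finite graph, and let $H$ be a hereditary subset of $E^0$. Suppose that $$(E^0\setminus H,\ r_E^{-1}(E^0\setminus H),\ s_E,\ r_E)$$ is a finite acyclic graph and that $v\ge H$ for all $v\in E^0\setminus H$. Assume furthermore that the set $s_E^{-1}(E^0\setminus H)\cap r_E^{-1}(H)$ is finite. Then $L_K(E)\cong L_K(E(H))$ as $K$-algebras.
   Context: A (directed) graph $E=(E^0,E^1,s,r)$ consists of two disjoint sets $E^0$ (vertices) and $E^1$ (edges) and maps $s=s_E,r=r_E:E^1\to E^0$ (source and range). It is row-finite if $|s^{-1}(v)|<\infty$ for all $v\in E^0$, and finite if $E^0$ and $E^1$ are finite. A vertex $v$ is regular if $0<|s^{-1}(v)|<\infty$. A path is a sequence of edges $p=e_1\cdots e_n$ ($n\ge1$) with $r(e_i)=s(e_{i+1})$; $s(p)=s(e_1)$, $r(p)=r(e_n)$. A cycle is a path with $s(p)=r(p)$ that does not revisit any other vertex; a graph is acyclic if it has no cycles. Write $v\ge w$ if there is a path from $v$ to $w$, and $v\ge S$ (for $S\subseteq E^0$) if $v\ge w$ for some $w\in S$. A subset $H\subseteq E^0$ is hereditary if $v\in H$, $w\in E^0$ and $v\ge w$ imply $w\in H$. (If $H$ is hereditary, every edge with range outside $H$ has source outside $H$, so the quadruple in the claim is a graph with the restricted maps.) For a hereditary subset $H$, let $F(H)$ be the set of paths $\alpha=e_1e_2\cdots e_n$ in $E$ with $s_E(e_n)\notin H$ and $r_E(e_n)\in H$, and let $\overline F(H)=\{\overline\alpha\mid\alpha\in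 F(H)\}$ be a disjoint copy of $F(H)$. The graph $E(H)$ has vertices $E(H)^0=H\sqcup F(H)$ and edges $E(H)^1=s_E^{-1}(H)\sqcup\overline F(H)$, with source and range given by $s_E,r_E$ on $s_E^{-1}(H)$, and $s_{E(H)}(\overline\alpha)=\alpha$, $r_{E(H)}(\overline\alpha)=r(\alpha)$ for $\alpha\in F(H)$. For a field $K$, the Leavitt path algebra $L_K(E)$ is the (associative, not necessarily unital if $E^0$ is infinite) $K$-algebra generated by $\{v,e,e^*\mid v\in E^0,e\in E^1\}$ subject to, for all $v,w\in E^0$, $e,f\in E^1$: (1) $vw=\delta_{v,w}w$; (2) $s(e)e=e=e\,r(e)$ and $r(e)e^*=e^*=e^*s(e)$; (3) $e^*f=\delta_{e,f}r(e)$; (4) $v=\sum_{e\in s^{-1}(v)}ee^*$ for every regular vertex $v$. *)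

theory Defs
  imports "Graph_Theory.Graph_Theory" "HOL-Library.Poly_Mapping"
begin

section \<open>Graphs\<close>

text \<open>
  A graph $E = (E^0,E^1,s,r)$ is a \<^const>\<open>wf_digraph\<close> with \<open>verts = E^0\<close>, \<open>arcs = E^1\<close>,
  \<open>tail = s\<close> and \<open>head = r\<close>; the set $s^{-1}(v)$ is \<^const>\<open>out_arcs\<close>.
  Paths have length at least one, whereas library walks may be empty.
\<close>

definition row_finite :: "('v, 'e) pre_digraph \<Rightarrow> bool" where
  "row_finite E \<longleftrightarrow> (\<forall>v \<in> verts E. finite (out_arcs E v))"

definition regular_vertex :: "('v, 'e) pre_digraph \<Rightarrow> 'v \<Rightarrow> bool" where
  "regular_vertex E v \<longleftrightarrow> v \<in> verts E \<and> finite (out_arcs E v) \<and> out_arcs E v \<noteq> {}"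

definition path_between :: "('v, 'e) pre_digraph \<Rightarrow> 'v \<Rightarrow> 'e list \<Rightarrow> 'v \<Rightarrow> bool" where
  "path_between E v p w \<longleftrightarrow> pre_digraph.awalk E v p w \<and> p \<noteq> []"

definition is_path :: "('v, 'e) pre_digraph \<Rightarrow> 'e list \<Rightarrow> bool" where
  "is_path E p \<longleftrightarrow> (\<exists>v w. path_between E v p w)"

definition acyclic_graph :: "('v, 'e) pre_digraph \<Rightarrow> bool" where
  "acyclic_graph E \<longleftrightarrow> (\<nexists>p. pre_digraph.cycle E p)"

definition connects :: "('v, 'e) pre_digraph \<Rightarrow> 'v \<Rightarrow> 'v \<Rightarrow> bool" where
  "connects E v w \<longleftrightarrow> (\<exists>p. path_between E v p w)"

definition connects_set :: "('v, 'e) pre_digraph \<Rightarrow> 'v \<Rightarrow> 'v set \<Rightarrow> bool" where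
  "connects_set E v S \<longleftrightarrow> (\<exists>w \<in> S. connects E v w)"

definition hereditary :: "('v, 'e) pre_digraph \<Rightarrow> 'v set \<Rightarrow> bool" where
  "hereditary E H \<longleftrightarrow>
     H \<subseteq> verts E \<and> (\<forall>v \<in> H. \<forall>w \<in> verts E. connects E v w \<longrightarrow> w \<in> H)"

definition complement_graph :: "('v, 'e) pre_digraph \<Rightarrow> 'v set \<Rightarrow> ('v, 'e) pre_digraph" where
  "complement_graph E H =
     \<lparr> verts = verts E - H,
       arcs = {e \<in> arcs E. head E e \<in> verts E - H},
       tail = tail E, head = head E \<rparr>"

definition entry_paths :: "('v, 'e) pre_digraph \<Rightarrow> 'v set \<Rightarrow> 'e list set" where
  "entry_paths E H = {p. is_path E p \<and> tail E (last p) \<notin> H \<and> head E (last p) \<in> H}"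

text \<open>
  The graph $E(H)$, with $F(H)$ = \<^const>\<open>entry_paths\<close>: among the vertices \<open>Inr \<alpha>\<close> is
  $\alpha \in F(H)$, among the edges it is $\overline\alpha \in \overline F(H)$.
\<close>

definition hereditary_graph ::
  "('v, 'e) pre_digraph \<Rightarrow> 'v set \<Rightarrow> ('v + 'e list, 'e + 'e list) pre_digraph" where
  "hereditary_graph E H =
     \<lparr> verts = H <+> entry_paths E H,
       arcs = {e \<in> arcs E. tail E e \<in> H} <+> entry_paths E H,
       tail = case_sum (\<lambda>e. Inl (tail E e)) (\<lambda>\<alpha>. Inr \<alpha>),
       head = case_sum (\<lambda>e. Inl (head E e)) (\<lambda>\<alpha>. Inl (head E (last \<alpha>))) \<rparr>"


section \<open>Associative algebras, not necessarily unital\<close>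

record ('k, 'a) algebra_struct =
  acarrier :: "'a set"
  azero :: 'a
  aadd :: "'a \<Rightarrow> 'a \<Rightarrow> 'a"
  amult :: "'a \<Rightarrow> 'a \<Rightarrow> 'a"
  ascale :: "'k \<Rightarrow> 'a \<Rightarrow> 'a"

locale assoc_algebra =
  fixes A :: "('k::field, 'a) algebra_struct"
  assumes zero_closed: "azero A \<in> acarrier A"
    and add_closed: "\<lbrakk>x \<in> acarrier A; y \<in> acarrier A\<rbrakk> \<Longrightarrow> aadd A x y \<in> acarrier A"
    and mult_closed: "\<lbrakk>x \<in> acarrier A; y \<in> acarrier A\<rbrakk> \<Longrightarrow> amult A x y \<in> acarrier A"
    and scale_closed: "x \<in> acarrier A \<Longrightarrow> ascale A c x \<in> acarrier A"
    and add_assoc: "\<lbrakk>x \<in> acarrier A; y \<in> acarrier A; z \<in> acarrier A\<rbrakk>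
          \<Longrightarrow> aadd A (aadd A x y) z = aadd A x (aadd A y z)"
    and add_commute: "\<lbrakk>x \<in> acarrier A; y \<in> acarrier A\<rbrakk> \<Longrightarrow> aadd A x y = aadd A y x"
    and add_zero: "x \<in> acarrier A \<Longrightarrow> aadd A (azero A) x = x"
    and add_inverse: "x \<in> acarrier A \<Longrightarrow> \<exists>y \<in> acarrier A. aadd A x y = azero A"
    and mult_assoc: "\<lbrakk>x \<in> acarrier A; y \<in> acarrier A; z \<in> acarrier A\<rbrakk>
          \<Longrightarrow> amult A (amult A x y) z = amult A x (amult A y z)"
    and mult_add_left: "\<lbrakk>x \<in> acarrier A; y \<in> acarrier A; z \<in> acarrier A\<rbrakk>
          \<Longrightarrow> amult A (aadd A x y) z = aadd A (amult A x z) (amult A y z)"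
    and mult_add_right: "\<lbrakk>x \<in> acarrier A; y \<in> acarrier A; z \<in> acarrier A\<rbrakk>
          \<Longrightarrow> amult A x (aadd A y z) = aadd A (amult A x y) (amult A x z)"
    and scale_one: "x \<in> acarrier A \<Longrightarrow> ascale A 1 x = x"
    and scale_scale: "x \<in> acarrier A \<Longrightarrow> ascale A c (ascale A d x) = ascale A (c * d) x"
    and scale_add: "\<lbrakk>x \<in> acarrier A; y \<in> acarrier A\<rbrakk>
          \<Longrightarrow> ascale A c (aadd A x y) = aadd A (ascale A c x) (ascale A c y)"
    and add_scale: "x \<in> acarrier A
          \<Longrightarrow> ascale A (c + d) x = aadd A (ascale A c x) (ascale A d x)"
    and scale_mult_left: "\<lbrakk>x \<in> acarrier A; y \<in> acarrier A\<rbrakk>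
          \<Longrightarrow> amult A (ascale A c x) y = ascale A c (amult A x y)"
    and scale_mult_right: "\<lbrakk>x \<in> acarrier A; y \<in> acarrier A\<rbrakk>
          \<Longrightarrow> amult A x (ascale A c y) = ascale A c (amult A x y)"

definition algebra_iso ::
  "('k, 'a) algebra_struct \<Rightarrow> ('k, 'b) algebra_struct \<Rightarrow> ('a \<Rightarrow> 'b) set" where
  "algebra_iso A B =
     {\<phi>. bij_betw \<phi> (acarrier A) (acarrier B) \<and>
         (\<forall>x \<in> acarrier A. \<forall>y \<in> acarrier A. \<phi> (aadd A x y) = aadd B (\<phi> x) (\<phi> y)) \<and>
         (\<forall>x \<in> acarrier A. \<forall>y \<in> acarrier A. \<phi> (amult A x y) = amult B (\<phi> x) (\<phi> y)) \<and>
         (\<forall>c. \<forall>x \<in> acarrier A. \<phi> (ascale A c x) = ascale B c (\<phi> x))}"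

definition isomorphic_algebras ::
  "('k, 'a) algebra_struct \<Rightarrow> ('k, 'b) algebra_struct \<Rightarrow> bool" where
  "isomorphic_algebras A B \<longleftrightarrow> algebra_iso A B \<noteq> {}"


section \<open>Free algebras and presentations\<close>

text \<open>
  Words are written additively, so that the convolution product of
  \<^theory>\<open>HOL-Library.Poly_Mapping\<close> makes \<open>'g free_monoid \<Rightarrow>\<^sub>0 'k\<close> the unital free
  algebra on \<open>'g\<close>.
\<close>

datatype 'g free_monoid = Word (letters: "'g list")

instantiation free_monoid :: (type) monoid_add
begin

definition zero_free_monoid :: "'a free_monoid" where
  "0 = Word []"

definition plus_free_monoid :: "'a free_monoid \<Rightarrow> 'a free_monoid \<Rightarrow> 'a free_monoid" where
  "u + v = Word (letters u @ letters v)"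

instance
  by standard (simp_all add: zero_free_monoid_def plus_free_monoid_def)

end

type_synonym ('g, 'k) free_poly = "'g free_monoid \<Rightarrow>\<^sub>0 'k"

definition gen :: "'g \<Rightarrow> ('g, 'k::field) free_poly" where
  "gen x = Poly_Mapping.single (Word [x]) 1"

definition scale_poly :: "'k::field \<Rightarrow> ('g, 'k) free_poly \<Rightarrow> ('g, 'k) free_poly" where
  "scale_poly c p = Poly_Mapping.map ((*) c) p"

text \<open>The non-unital free algebra on the set \<open>X\<close>: no constant term is allowed.\<close>

definition free_algebra :: "'g set \<Rightarrow> ('g, 'k::field) free_poly set" where
  "free_algebra X = {p. \<forall>w \<in> Poly_Mapping.keys p. letters w \<noteq> [] \<and> set (letters w) \<subseteq> X}"

inductive_set generated_ideal ::
  "'g set \<Rightarrow> ('g, 'k::field) free_poly set \<Rightarrow> ('g, 'k) free_poly set"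
  for X :: "'g set" and R :: "('g, 'k::field) free_poly set"
where
  zero: "0 \<in> generated_ideal X R"
| relator: "p \<in> R \<Longrightarrow> p \<in> generated_ideal X R"
| add: "\<lbrakk>p \<in> generated_ideal X R; q \<in> generated_ideal X R\<rbrakk> \<Longrightarrow> p + q \<in> generated_ideal X R"
| scale: "p \<in> generated_ideal X R \<Longrightarrow> scale_poly c p \<in> generated_ideal X R"
| left: "\<lbrakk>a \<in> free_algebra X; p \<in> generated_ideal X R\<rbrakk> \<Longrightarrow> a * p \<in> generated_ideal X R"
| right: "\<lbrakk>p \<in> generated_ideal X R; a \<in> free_algebra X\<rbrakk> \<Longrightarrow> p * a \<in> generated_ideal X R"

definition presentation_rel ::
  "'g set \<Rightarrow> ('g, 'k::field) free_poly set \<Rightarrow> (('g, 'k) free_poly \<times> ('g, 'k) free_poly) set"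
where
  "presentation_rel X R =
     {(p, q). p \<in> free_algebra X \<and> q \<in> free_algebra X \<and> p - q \<in> generated_ideal X R}"

text \<open>
  The quotient of the free algebra on \<open>X\<close> by the ideal generated by \<open>R\<close>. Each union below
  consists of equal classes; see the lemmas \<open>presented_algebra_add\<close> etc.
\<close>

definition presented_algebra ::
  "'g set \<Rightarrow> ('g, 'k::field) free_poly set \<Rightarrow> ('k, ('g, 'k) free_poly set) algebra_struct" where
  "presented_algebra X R =
     \<lparr> acarrier = free_algebra X // presentation_rel X R,
       azero = presentation_rel X R `` {0},
       aadd = (\<lambda>P Q. \<Union>p \<in> P. \<Union>q \<in> Q. presentation_rel X R `` {p + q}),
       amult = (\<lambda>P Q. \<Union>p \<in> P. \<Union>q \<in> Q. presentation_rel X R `` {p * q}),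
       ascale = (\<lambda>c P. \<Union>p \<in> P. presentation_rel X R `` {scale_poly c p}) \<rparr>"


section \<open>Leavitt path algebras\<close>

datatype ('v, 'e) lpa_gen = Vert 'v | Edge 'e | Ghost 'e

definition lpa_gens :: "('v, 'e) pre_digraph \<Rightarrow> ('v, 'e) lpa_gen set" where
  "lpa_gens E = Vert ` verts E \<union> Edge ` arcs E \<union> Ghost ` arcs E"

definition lpa_relators :: "('v, 'e) pre_digraph \<Rightarrow> (('v, 'e) lpa_gen, 'k::field) free_poly set"
where
  "lpa_relators E =
     {gen (Vert v) * gen (Vert w) - (if v = w then gen (Vert w) else 0) | v w.
        v \<in> verts E \<and> w \<in> verts E} \<union>
     {gen (Vert (tail E e)) * gen (Edge e) - gen (Edge e) | e. e \<in> arcs E} \<union>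
     {gen (Edge e) * gen (Vert (head E e)) - gen (Edge e) | e. e \<in> arcs E} \<union>
     {gen (Vert (head E e)) * gen (Ghost e) - gen (Ghost e) | e. e \<in> arcs E} \<union>
     {gen (Ghost e) * gen (Vert (tail E e)) - gen (Ghost e) | e. e \<in> arcs E} \<union>
     {gen (Ghost e) * gen (Edge f) - (if e = f then gen (Vert (head E e)) else 0) | e f.
        e \<in> arcs E \<and> f \<in> arcs E} \<union>
     {gen (Vert v) - (\<Sum>e \<in> out_arcs E v. gen (Edge e) * gen (Ghost e)) | v.
        regular_vertex E v}"

definition leavitt_path_algebra ::
  "('v, 'e) pre_digraph \<Rightarrow> ('k::field, (('v, 'e) lpa_gen, 'k) free_poly set) algebra_struct"
where
  "leavitt_path_algebra E = presented_algebra (lpa_gens E) (lpa_relators E)"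


section \<open>Well-definedness\<close>

lemma wf_digraph_hereditary_graph:
  assumes "wf_digraph E" "hereditary E H"
  shows "wf_digraph (hereditary_graph E H)"
proof -
  interpret wf_digraph E by fact
  have "head E e \<in> H" if e: "e \<in> arcs E" "tail E e \<in> H" for e
  proof -
    have "path_between E (tail E e) [e] (head E e)"
      using e by (simp add: path_between_def arc_implies_awalk)
    then have "connects E (tail E e) (head E e)"
      unfolding connects_def by blast
    with e assms(2) show ?thesis
      by (auto simp: hereditary_def)
  qed
  then show ?thesis
    by unfold_locales (auto simp: hereditary_graph_def entry_paths_def)
qed

lemma scale_poly_conv_mult: "scale_poly c p = Poly_Mapping.single 0 c * p"
  unfolding scale_poly_def by (rule mult_map_scale_conv_mult)

lemma single_0_commute:
  fixes p :: "('g, 'k::field) free_poly"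
  shows "p * Poly_Mapping.single 0 c = Poly_Mapping.single 0 c * p"
proof (induction p rule: update_induct)
  case const
  show ?case by simp
next
  case (update p a b)
  then have "Poly_Mapping.update a b p = p + Poly_Mapping.single a b"
    by (intro poly_mapping_eqI)
      (auto simp: lookup_update lookup_add lookup_single when_def in_keys_iff)
  with update show ?case
    by (simp add: algebra_simps mult_single)
qed

lemma scale_poly_mult_left: "scale_poly c p * q = scale_poly c (p * q)"
  by (simp add: scale_poly_conv_mult mult.assoc)

lemma scale_poly_mult_right: "p * scale_poly c q = scale_poly c (p * q)"
  by (metis scale_poly_conv_mult mult.assoc single_0_commute)

lemma scale_poly_minus_one: "scale_poly (- 1) p = - p"
  by (simp add: scale_poly_conv_mult single_uminus)

lemma free_algebra_zero: "0 \<in> free_algebra X"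
  by (simp add: free_algebra_def)

lemma free_algebra_add: "p \<in> free_algebra X \<Longrightarrow> q \<in> free_algebra X \<Longrightarrow> p + q \<in> free_algebra X"
  using keys_add[of p q] by (fastforce simp: free_algebra_def)

lemma free_algebra_mult: "p \<in> free_algebra X \<Longrightarrow> q \<in> free_algebra X \<Longrightarrow> p * q \<in> free_algebra X"
  using keys_mult[of p q] by (fastforce simp: free_algebra_def plus_free_monoid_def)

lemma free_algebra_scale: "p \<in> free_algebra X \<Longrightarrow> scale_poly c p \<in> free_algebra X"
  using keys_mult[of "Poly_Mapping.single 0 c" p]
  by (fastforce simp: free_algebra_def scale_poly_conv_mult split: if_splits)

lemma free_algebra_uminus: "p \<in> free_algebra X \<Longrightarrow> - p \<in> free_algebra X"
  by (metis free_algebra_scale scale_poly_minus_one)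

lemma generated_ideal_uminus: "p \<in> generated_ideal X R \<Longrightarrow> - p \<in> generated_ideal X R"
  by (metis generated_ideal.scale scale_poly_minus_one)

lemma equiv_presentation_rel: "equiv (free_algebra X) (presentation_rel X R)"
proof (rule equivI)
  show "presentation_rel X R \<subseteq> free_algebra X \<times> free_algebra X"
    by (auto simp: presentation_rel_def)
  show "refl_on (free_algebra X) (presentation_rel X R)"
    by (auto simp: refl_on_def presentation_rel_def generated_ideal.zero)
  show "sym (presentation_rel X R)"
    using generated_ideal_uminus by (fastforce simp: sym_def presentation_rel_def)
  show "trans (presentation_rel X R)"
  proof (rule transI)
    fix p q r assume "(p, q) \<in> presentation_rel X R" "(q, r) \<in> presentation_rel X R"
    then show "(p, r) \<in> presentation_rel X R"
      using generated_ideal.add[of "p - q" X R "q - r"] by (auto simp: presentation_rel_def)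
  qed
qed

abbreviation presentation_class ::
  "'g set \<Rightarrow> ('g, 'k::field) free_poly set \<Rightarrow> ('g, 'k) free_poly \<Rightarrow> ('g, 'k) free_poly set" where
  "presentation_class X R p \<equiv> presentation_rel X R `` {p}"

lemma presentation_rel_add:
  assumes "(p, p') \<in> presentation_rel X R" "(q, q') \<in> presentation_rel X R"
  shows "(p + q, p' + q') \<in> presentation_rel X R"
  using assms generated_ideal.add[of "p - p'" X R "q - q'"]
  by (auto simp: presentation_rel_def free_algebra_add algebra_simps)

lemma presentation_rel_mult:
  assumes "(p, p') \<in> presentation_rel X R" "(q, q') \<in> presentation_rel X R"
  shows "(p * q, p' * q') \<in> presentation_rel X R"
proof -
  have "(p - p') * q + p' * (q - q') \<in> generated_ideal X R"
    using assms unfolding presentation_rel_def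
    by (blast intro: generated_ideal.add generated_ideal.left generated_ideal.right)
  also have "(p - p') * q + p' * (q - q') = p * q - p' * q'"
    by (simp add: algebra_simps)
  finally show ?thesis
    using assms by (auto simp: presentation_rel_def free_algebra_mult)
qed

lemma presentation_rel_scale:
  assumes "(p, p') \<in> presentation_rel X R"
  shows "(scale_poly c p, scale_poly c p') \<in> presentation_rel X R"
  using assms generated_ideal.scale[of "p - p'" X R c]
  by (auto simp: presentation_rel_def scale_poly_conv_mult algebra_simps
      intro: free_algebra_scale[unfolded scale_poly_conv_mult])

lemma presented_algebra_carrier:
  "acarrier (presented_algebra X R) = presentation_class X R ` free_algebra X"
  by (auto simp: presented_algebra_def quotient_def)

lemma presented_algebra_zero: "azero (presented_algebra X R) = presentation_class X R 0"
  by (simp add: presented_algebra_def)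

lemma presented_algebra_add:
  assumes "p \<in> free_algebra X" "q \<in> free_algebra X"
  shows "aadd (presented_algebra X R) (presentation_class X R p) (presentation_class X R q)
           = presentation_class X R (p + q)"
proof -
  note eq = equiv_presentation_rel[of X R]
  have "congruent2 (presentation_rel X R) (presentation_rel X R)
          (\<lambda>p q. presentation_class X R (p + q))"
    unfolding congruent2_def using equiv_class_eq[OF eq] presentation_rel_add by blast
  from UN_equiv_class2[OF eq eq this assms] show ?thesis
    by (simp add: presented_algebra_def)
qed

lemma presented_algebra_mult:
  assumes "p \<in> free_algebra X" "q \<in> free_algebra X"
  shows "amult (presented_algebra X R) (presentation_class X R p) (presentation_class X R q)
           = presentation_class X R (p * q)"
proof -
  note eq = equiv_presentation_rel[of X R]
  have "congruent2 (presentation_rel X R) (presentation_rel X R)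
          (\<lambda>p q. presentation_class X R (p * q))"
    unfolding congruent2_def using equiv_class_eq[OF eq] presentation_rel_mult by blast
  from UN_equiv_class2[OF eq eq this assms] show ?thesis
    by (simp add: presented_algebra_def)
qed

lemma presented_algebra_scale:
  assumes "p \<in> free_algebra X"
  shows "ascale (presented_algebra X R) c (presentation_class X R p)
           = presentation_class X R (scale_poly c p)"
proof -
  note eq = equiv_presentation_rel[of X R]
  have "congruent (presentation_rel X R) (\<lambda>p. presentation_class X R (scale_poly c p))"
    unfolding congruent_def using equiv_class_eq[OF eq] presentation_rel_scale by blast
  from UN_equiv_class[OF eq this assms] show ?thesis
    by (simp add: presented_algebra_def)
qed

theorem assoc_algebra_presented_algebra: "assoc_algebra (presented_algebra X R)"
proof -
  note ops = presented_algebra_carrier presented_algebra_zero presented_algebra_add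
    presented_algebra_mult presented_algebra_scale
  note closed = free_algebra_zero free_algebra_add free_algebra_mult free_algebra_scale
    free_algebra_uminus
  have inverse: "\<exists>y \<in> acarrier (presented_algebra X R).
      aadd (presented_algebra X R) x y = azero (presented_algebra X R)"
    if "x \<in> acarrier (presented_algebra X R)" for x
  proof -
    obtain p where p: "x = presentation_class X R p" "p \<in> free_algebra X"
      using \<open>x \<in> _\<close> by (auto simp: ops)
    then have "aadd (presented_algebra X R) x (presentation_class X R (- p))
        = azero (presented_algebra X R)"
      by (simp add: ops closed)
    with p show ?thesis
      by (auto simp: presented_algebra_carrier closed)
  qed
  show ?thesis
    by (standard; (erule inverse)?)
      (auto simp: ops closed algebra_simps scale_poly_mult_left scale_poly_mult_right
        simp flip: single_add mult_single,
       auto simp: scale_poly_conv_mult mult_single algebra_simps single_add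
        simp flip: mult.assoc)
qed

corollary assoc_algebra_leavitt_path_algebra: "assoc_algebra (leavitt_path_algebra E)"
  unfolding leavitt_path_algebra_def by (rule assoc_algebra_presented_algebra)

lemma lpa_relators_subset:
  assumes "wf_digraph E"
  shows "lpa_relators E \<subseteq> free_algebra (lpa_gens E)"
proof -
  interpret wf_digraph E by fact
  have diff: "p - q \<in> free_algebra X" if "p \<in> free_algebra X" "q \<in> free_algebra X"
    for p q :: "('g, 'k::field) free_poly" and X
    using free_algebra_add[OF that(1) free_algebra_uminus[OF that(2)]] by simp
  have sum: "(\<Sum>i \<in> I. f i) \<in> free_algebra X" if "\<And>i. i \<in> I \<Longrightarrow> f i \<in> free_algebra X"
    for f :: "'i \<Rightarrow> ('g, 'k::field) free_poly" and I X
    using that by (induction I rule: infinite_finite_induct)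
      (auto simp: free_algebra_zero free_algebra_add)
  have gen: "gen x \<in> free_algebra (lpa_gens E)" if "x \<in> lpa_gens E" for x
    using that by (simp add: gen_def free_algebra_def)
  show ?thesis
    by (auto simp: lpa_relators_def regular_vertex_def out_arcs_def lpa_gens_def
        intro!: diff sum free_algebra_mult gen[unfolded lpa_gens_def] free_algebra_zero)
qed

end

theory Submission
  imports Defs
begin

text \<open>
  For a vertex $v$ let $F_v$ be the set of paths from $v$ that stop as soon as they enter $H$, so
  that $F_v = \{v\}$ for $v \in H$. Since the graph outside $H$ is finite and acyclic and every
  vertex reaches $H$, iterating relation (4) gives $v = \sum_{\alpha \in F_v} \alpha\alpha^*$
  in $L_K(E)$. Moreover no element of $F(H)$ is a proper prefix of another, hence
  $\alpha^*\beta = \delta_{\alpha,\beta}\, r(\alpha)$. Therefore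
  \[ \alpha \mapsto \alpha\alpha^*, \quad \overline\alpha \mapsto \alpha, \quad
     \overline\alpha{}^* \mapsto \alpha^* \]
  extends to a homomorphism $L_K(E(H)) \to L_K(E)$ that is the identity on the part inside $H$. Its
  inverse sends a vertex $v \notin H$ to $\sum_{\alpha \in F_v} \alpha$ and an edge $e$ with
  source outside $H$ to $\sum_{\beta \in F_{r(e)}} \overline{e\beta}\, \overline\beta{}^*$,
  where $\overline\beta$ is the vertex $r(e)$ if $r(e) \in H$.
\<close>

section \<open>Homomorphisms between presented algebras\<close>

text \<open>The formulas for the inverse are forced. A vertex v outside H is the sum of
  \<alpha>\<alpha>^* over F_v, and each summand is the image of the vertex \<alpha> of E(H).
  Likewise e = e r(e) is the sum of (e\<beta>)\<beta>^* over \<beta> in F_{r(e)}, and both factors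
  are images of generators. Conversely, the vertex \<alpha> of E(H) emits only its own edge, so once
  that edge is sent to \<alpha>, relation (4) leaves \<alpha>\<alpha>^* as the only image of the
  vertex. No separate injectivity argument is made: both maps are given on generators and checked on
  relators, and their composites are compared with the identity on generators. Two points shape the
  details. The algebras may lack a unit, so no constant term may enter a calculation. And F_v
  contains the empty path exactly when v lies in H, while E(H) has no edge for it; letting the
  vertex itself stand in for that edge and its ghost makes one formula cover edges that enter H and
  edges that stay outside.\<close>

definition lift_gens ::
  "('g \<Rightarrow> ('h, 'k::field) free_poly) \<Rightarrow> ('g, 'k) free_poly \<Rightarrow> ('h, 'k) free_poly" where
  "lift_gens h p =
     (\<Sum>w \<in> Poly_Mapping.keys p. scale_poly (Poly_Mapping.lookup p w) (prod_list (map h (letters w))))"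

lemma scale_poly_0_left [simp]: "scale_poly 0 p = 0"
  by (simp add: scale_poly_conv_mult)

lemma scale_poly_1 [simp]: "scale_poly 1 p = p"
  by (simp add: scale_poly_conv_mult)

lemma scale_poly_add_left: "scale_poly (c + d) p = scale_poly c p + scale_poly d p"
  by (simp add: scale_poly_conv_mult single_add algebra_simps)

lemma scale_poly_add_right: "scale_poly c (p + q) = scale_poly c p + scale_poly c q"
  by (simp add: scale_poly_conv_mult algebra_simps)

lemma scale_poly_scale_poly: "scale_poly c (scale_poly d p) = scale_poly (c * d) p"
  by (simp add: scale_poly_conv_mult mult_single flip: mult.assoc)

lemma scale_poly_single: "scale_poly c (Poly_Mapping.single w d) = Poly_Mapping.single w (c * d)"
  by (simp add: scale_poly_conv_mult mult_single)

text \<open>Supports can shrink when polynomials are added; extra words contribute zero, so a common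
  index set can be used for p, q and p + q.\<close>

lemma lift_gens_superset:
  assumes "finite A" "Poly_Mapping.keys p \<subseteq> A"
  shows "lift_gens h p = (\<Sum>w \<in> A. scale_poly (Poly_Mapping.lookup p w) (prod_list (map h (letters w))))"
  unfolding lift_gens_def using assms
  by (intro sum.mono_neutral_left) (auto simp: in_keys_iff)

lemma lift_gens_0 [simp]: "lift_gens h 0 = 0"
  by (simp add: lift_gens_def)

lemma lift_gens_add: "lift_gens h (p + q) = lift_gens h p + lift_gens h q"
proof -
  let ?A = "Poly_Mapping.keys p \<union> Poly_Mapping.keys q"
  have "finite ?A" by simp
  then show ?thesis
    using lift_gens_superset[of ?A p h] lift_gens_superset[of ?A q h]
      lift_gens_superset[of ?A "p + q" h] keys_add[of p q]
    by (simp add: lookup_add scale_poly_add_left sum.distrib)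
qed

lemma lift_gens_single:
  "lift_gens h (Poly_Mapping.single w c) = scale_poly c (prod_list (map h (letters w)))"
  by (simp add: lift_gens_def)

lemma lift_gens_gen [simp]: "lift_gens h (gen x) = h x"
  by (simp add: gen_def lift_gens_single)

lemma free_poly_induct [case_names single add]:
  fixes p :: "('g, 'k::field) free_poly"
  assumes "\<And>w c. P (Poly_Mapping.single w c)" "\<And>p q. P p \<Longrightarrow> P q \<Longrightarrow> P (p + q)"
  shows "P p"
proof (induction p rule: update_induct)
  case const
  \<comment> \<open>The zero polynomial is a monomial with coefficient 0, so no separate case is
    needed.\<close>
  show ?case using assms(1)[of undefined 0] by simp
next
  case (update p a b)
  then have "Poly_Mapping.update a b p = p + Poly_Mapping.single a b"
    by (intro poly_mapping_eqI)
      (auto simp: lookup_update lookup_add lookup_single when_def in_keys_iff)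
  with update assms show ?case by simp
qed

lemma lift_gens_mult: "lift_gens h (p * q) = lift_gens h p * lift_gens h q"
proof (induction p rule: free_poly_induct)
  case (single w c)
  show ?case
  proof (induction q rule: free_poly_induct)
    case (single w' c')
    show ?case
      by (simp add: mult_single lift_gens_single plus_free_monoid_def scale_poly_mult_left
          scale_poly_mult_right scale_poly_scale_poly mult.commute)
  qed (simp add: lift_gens_add algebra_simps)
qed (simp add: lift_gens_add algebra_simps)

lemma lift_gens_scale: "lift_gens h (scale_poly c p) = scale_poly c (lift_gens h p)"
  by (induction p rule: free_poly_induct)
    (simp_all add: lift_gens_add scale_poly_single lift_gens_single scale_poly_add_right
      scale_poly_scale_poly)

lemma lift_gens_diff: "lift_gens h (p - q) = lift_gens h p - lift_gens h q"
  using lift_gens_add[of h "p - q" q] by simp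

lemma lift_gens_sum: "lift_gens h (\<Sum>i \<in> I. f i) = (\<Sum>i \<in> I. lift_gens h (f i))"
  by (induction I rule: infinite_finite_induct) (simp_all add: lift_gens_add)

lemma free_algebra_gen: "x \<in> X \<Longrightarrow> gen x \<in> free_algebra X"
  by (simp add: gen_def free_algebra_def)

lemma free_algebra_sum:
  "(\<And>i. i \<in> I \<Longrightarrow> f i \<in> free_algebra X) \<Longrightarrow> (\<Sum>i \<in> I. f i) \<in> free_algebra X"
  by (induction I rule: infinite_finite_induct) (auto simp: free_algebra_zero free_algebra_add)

text \<open>A polynomial is its own image under \<open>lift_gens gen\<close>, that is, a linear
  combination of products of generators. Words are nonempty, so the induction never meets the
  constant 1.\<close>

lemma free_algebra_induct [consumes 1, case_names zero gen add mult scale]: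
  fixes p :: "('g, 'k::field) free_poly"
  assumes p: "p \<in> free_algebra X"
    and zero: "P 0"
    and gen: "\<And>x. x \<in> X \<Longrightarrow> P (gen x)"
    and add: "\<And>p q. P p \<Longrightarrow> P q \<Longrightarrow> P (p + q)"
    and mult: "\<And>p q. P p \<Longrightarrow> P q \<Longrightarrow> P (p * q)"
    and scale: "\<And>c p. P p \<Longrightarrow> P (scale_poly c p)"
  shows "P p"
proof -
  have word: "P (prod_list (map gen xs))" if "xs \<noteq> []" "set xs \<subseteq> X" for xs
    using that by (induction xs rule: list_nonempty_induct) (simp_all add: gen mult)
  have monomial: "prod_list (map gen xs) = (Poly_Mapping.single (Word xs) 1 :: ('g, 'k) free_poly)"
    for xs
    by (induction xs)
      (simp_all add: gen_def mult_single plus_free_monoid_def flip: zero_free_monoid_def)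
  have lift: "lift_gens gen q = q" for q :: "('g, 'k) free_poly"
    by (induction q rule: free_poly_induct)
      (simp_all add: lift_gens_add lift_gens_single scale_poly_single monomial)
  have sum: "P (\<Sum>i \<in> I. f i)" if "\<And>i. i \<in> I \<Longrightarrow> P (f i)"
    for I :: "'g free_monoid set" and f
    using that by (induction I rule: infinite_finite_induct) (auto simp: zero add)
  have "P (lift_gens gen p)"
    unfolding lift_gens_def using p by (intro sum scale word) (auto simp: free_algebra_def)
  then show ?thesis by (simp add: lift)
qed

lemma lift_gens_free_algebra:
  assumes "p \<in> free_algebra X" "\<And>x. x \<in> X \<Longrightarrow> h x \<in> free_algebra Y"
  shows "lift_gens h p \<in> free_algebra Y"
  using assms(1) by (induction rule: free_algebra_induct)
    (simp_all add: free_algebra_zero assms(2) lift_gens_add free_algebra_add lift_gens_mult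
      free_algebra_mult lift_gens_scale free_algebra_scale)

text \<open>The condition on h keeps the multipliers inside the target free algebra, so that the
  closure rules \<open>left\<close> and \<open>right\<close> carry over.\<close>

lemma lift_gens_generated_ideal:
  assumes "p \<in> generated_ideal X R" "\<And>x. x \<in> X \<Longrightarrow> h x \<in> free_algebra Y"
    "\<And>r. r \<in> R \<Longrightarrow> lift_gens h r \<in> generated_ideal Y S"
  shows "lift_gens h p \<in> generated_ideal Y S"
  using assms(1) by (induction rule: generated_ideal.induct)
    (auto simp: lift_gens_add lift_gens_mult lift_gens_scale generated_ideal.zero assms(3)
      intro: generated_ideal.intros(3-6) lift_gens_free_algebra[OF _ assms(2)])

lemma lift_gens_presentation_rel:
  assumes "(p, q) \<in> presentation_rel X R" "\<And>x. x \<in> X \<Longrightarrow> h x \<in> free_algebra Y"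
    "\<And>r. r \<in> R \<Longrightarrow> lift_gens h r \<in> generated_ideal Y S"
  shows "(lift_gens h p, lift_gens h q) \<in> presentation_rel Y S"
  using assms lift_gens_generated_ideal[of "p - q" X R h Y S] unfolding presentation_rel_def
  by (auto simp: lift_gens_diff intro: lift_gens_free_algebra)

text \<open>Both sides respect sums, products and scalars, and the relation is a congruence, so
  agreement on generators spreads to the whole free algebra.\<close>

lemma lift_gens_inverse:
  assumes "p \<in> free_algebra X"
    "\<And>x. x \<in> X \<Longrightarrow> (lift_gens k (h x), gen x) \<in> presentation_rel X R"
  shows "(lift_gens k (lift_gens h p), p) \<in> presentation_rel X R"
  using assms(1)
proof (induction rule: free_algebra_induct)
  case zero
  show ?case by (simp add: presentation_rel_def free_algebra_zero generated_ideal.zero)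
qed (auto simp: assms(2) lift_gens_add lift_gens_mult lift_gens_scale
    intro: presentation_rel_add presentation_rel_mult presentation_rel_scale)

theorem isomorphic_presented_algebras:
  fixes R :: "('g, 'k::field) free_poly set" and S :: "('h, 'k) free_poly set"
  assumes h: "\<And>x. x \<in> X \<Longrightarrow> h x \<in> free_algebra Y"
    and k: "\<And>y. y \<in> Y \<Longrightarrow> k y \<in> free_algebra X"
    and hR: "\<And>r. r \<in> R \<Longrightarrow> lift_gens h r \<in> generated_ideal Y S"
    and kS: "\<And>s. s \<in> S \<Longrightarrow> lift_gens k s \<in> generated_ideal X R"
    and kh: "\<And>x. x \<in> X \<Longrightarrow> (lift_gens k (h x), gen x) \<in> presentation_rel X R"
    and hk: "\<And>y. y \<in> Y \<Longrightarrow> (lift_gens h (k y), gen y) \<in> presentation_rel Y S"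
  shows "isomorphic_algebras (presented_algebra X R) (presented_algebra Y S)"
proof -
  note eqX = equiv_presentation_rel[of X R] and eqY = equiv_presentation_rel[of Y S]
  \<comment> \<open>The union runs over equal classes once h is known to respect the relation; this
    is the same device by which the operations of \<open>presented_algebra\<close> are
    defined.\<close>
  define f where "f P = (\<Union>p \<in> P. presentation_class Y S (lift_gens h p))" for P
  define g where "g P = (\<Union>p \<in> P. presentation_class X R (lift_gens k p))" for P
  have "congruent (presentation_rel X R) (\<lambda>p. presentation_class Y S (lift_gens h p))"
    unfolding congruent_def
    using equiv_class_eq[OF eqY] lift_gens_presentation_rel[OF _ h hR] by blast
  from UN_equiv_class[OF eqX this]
  have f: "f (presentation_class X R p) = presentation_class Y S (lift_gens h p)"
    if "p \<in> free_algebra X" for p using that by (simp add: f_def)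
  have "congruent (presentation_rel Y S) (\<lambda>p. presentation_class X R (lift_gens k p))"
    unfolding congruent_def
    using equiv_class_eq[OF eqX] lift_gens_presentation_rel[OF _ k kS] by blast
  from UN_equiv_class[OF eqY this]
  have g: "g (presentation_class Y S p) = presentation_class X R (lift_gens k p)"
    if "p \<in> free_algebra Y" for p using that by (simp add: g_def)
  have fa_h: "lift_gens h p \<in> free_algebra Y" if "p \<in> free_algebra X" for p
    using lift_gens_free_algebra[OF that h] .
  have fa_k: "lift_gens k p \<in> free_algebra X" if "p \<in> free_algebra Y" for p
    using lift_gens_free_algebra[OF that k] .
  have gf: "g (f (presentation_class X R p)) = presentation_class X R p"
    if "p \<in> free_algebra X" for p
    using that equiv_class_eq[OF eqX lift_gens_inverse[OF that kh]] by (simp add: f g fa_h)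
  have fg: "f (g (presentation_class Y S p)) = presentation_class Y S p"
    if "p \<in> free_algebra Y" for p
    using that equiv_class_eq[OF eqY lift_gens_inverse[OF that hk]] by (simp add: f g fa_k)
  have "bij_betw f (acarrier (presented_algebra X R)) (acarrier (presented_algebra Y S))"
  proof (rule bij_betw_byWitness[where f' = g])
    show "f ` acarrier (presented_algebra X R) \<subseteq> acarrier (presented_algebra Y S)"
      unfolding presented_algebra_carrier image_subset_iff using f fa_h by simp
    show "g ` acarrier (presented_algebra Y S) \<subseteq> acarrier (presented_algebra X R)"
      unfolding presented_algebra_carrier image_subset_iff using g fa_k by simp
  qed (auto simp only: presented_algebra_carrier gf fg)
  then have "f \<in> algebra_iso (presented_algebra X R) (presented_algebra Y S)"
    unfolding algebra_iso_def
    by (auto simp: presented_algebra_carrier presented_algebra_add presented_algebra_mult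
        presented_algebra_scale free_algebra_add free_algebra_mult free_algebra_scale f fa_h
        lift_gens_add lift_gens_mult lift_gens_scale)
  then show ?thesis unfolding isomorphic_algebras_def by blast
qed

section \<open>Calculating in a Leavitt path algebra\<close>

type_synonym ('v, 'e, 'k) lpa_poly = "(('v, 'e) lpa_gen, 'k) free_poly"

abbreviation lpa_free :: "('v, 'e) pre_digraph \<Rightarrow> (('v, 'e) lpa_gen, 'k::field) free_poly set" where
  "lpa_free E \<equiv> free_algebra (lpa_gens E)"

text \<open>Calculations stay with representatives instead of classes. Membership in
  \<open>lpa_free\<close> is part of the relation, so each congruence also certifies that its two
  sides are admissible; the price is a membership condition for every factor that is kept
  fixed.\<close>

definition lpa_eq ::
  "(('v, 'e) lpa_gen, 'k::field) free_poly \<Rightarrow> ('v, 'e) pre_digraph \<Rightarrow>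
     (('v, 'e) lpa_gen, 'k) free_poly \<Rightarrow> bool"
  ("(_ \<approx>\<^bsub>_\<^esub> _)" [51, 0, 51] 50)
  where "p \<approx>\<^bsub>E\<^esub> q \<longleftrightarrow> (p, q) \<in> presentation_rel (lpa_gens E) (lpa_relators E)"

lemma lpa_gens_iff [simp]:
  "Vert v \<in> lpa_gens E \<longleftrightarrow> v \<in> verts E"
  "Edge e \<in> lpa_gens E \<longleftrightarrow> e \<in> arcs E"
  "Ghost e \<in> lpa_gens E \<longleftrightarrow> e \<in> arcs E"
  by (auto simp: lpa_gens_def)

lemma lpa_eq_free:
  assumes "p \<approx>\<^bsub>E\<^esub> q"
  shows "p \<in> lpa_free E" "q \<in> lpa_free E"
  using assms by (auto simp: lpa_eq_def presentation_rel_def)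

lemma lpa_eq_ideal: "p \<approx>\<^bsub>E\<^esub> q \<Longrightarrow> p - q \<in> generated_ideal (lpa_gens E) (lpa_relators E)"
  by (simp add: lpa_eq_def presentation_rel_def)

lemma lpa_eq_refl: "p \<in> lpa_free E \<Longrightarrow> p \<approx>\<^bsub>E\<^esub> p"
  by (simp add: lpa_eq_def presentation_rel_def generated_ideal.zero)

lemma lpa_eq_sym: "p \<approx>\<^bsub>E\<^esub> q \<Longrightarrow> q \<approx>\<^bsub>E\<^esub> p"
  unfolding lpa_eq_def using equiv_presentation_rel by (metis equivE symE)

lemma lpa_eq_trans [trans]: "p \<approx>\<^bsub>E\<^esub> q \<Longrightarrow> q \<approx>\<^bsub>E\<^esub> r \<Longrightarrow> p \<approx>\<^bsub>E\<^esub> r"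
  unfolding lpa_eq_def using equiv_presentation_rel by (metis equivE transE)

lemma lpa_eq_add: "p \<approx>\<^bsub>E\<^esub> p' \<Longrightarrow> q \<approx>\<^bsub>E\<^esub> q' \<Longrightarrow> p + q \<approx>\<^bsub>E\<^esub> p' + q'"
  unfolding lpa_eq_def by (rule presentation_rel_add)

lemma lpa_eq_mult: "p \<approx>\<^bsub>E\<^esub> p' \<Longrightarrow> q \<approx>\<^bsub>E\<^esub> q' \<Longrightarrow> p * q \<approx>\<^bsub>E\<^esub> p' * q'"
  unfolding lpa_eq_def by (rule presentation_rel_mult)

lemma lpa_eq_left: "p \<approx>\<^bsub>E\<^esub> q \<Longrightarrow> a \<in> lpa_free E \<Longrightarrow> a * p \<approx>\<^bsub>E\<^esub> a * q"
  by (intro lpa_eq_mult lpa_eq_refl)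

lemma lpa_eq_right: "p \<approx>\<^bsub>E\<^esub> q \<Longrightarrow> a \<in> lpa_free E \<Longrightarrow> p * a \<approx>\<^bsub>E\<^esub> q * a"
  by (intro lpa_eq_mult lpa_eq_refl)

lemma lpa_eq_mid:
  "p \<approx>\<^bsub>E\<^esub> q \<Longrightarrow> a \<in> lpa_free E \<Longrightarrow> b \<in> lpa_free E \<Longrightarrow> a * p * b \<approx>\<^bsub>E\<^esub> a * q * b"
  by (intro lpa_eq_mult lpa_eq_refl)

lemma lpa_eq_sum: "(\<And>i. i \<in> I \<Longrightarrow> f i \<approx>\<^bsub>E\<^esub> g i) \<Longrightarrow> (\<Sum>i \<in> I. f i) \<approx>\<^bsub>E\<^esub> (\<Sum>i \<in> I. g i)"
  by (induction I rule: infinite_finite_induct)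
    (auto simp: lpa_eq_refl free_algebra_zero lpa_eq_add)

lemma lpa_eq_sum_zero: "(\<And>i. i \<in> I \<Longrightarrow> f i \<approx>\<^bsub>E\<^esub> 0) \<Longrightarrow> (\<Sum>i \<in> I. f i) \<approx>\<^bsub>E\<^esub> 0"
  using lpa_eq_sum[of I f E "\<lambda>_. 0"] by simp

lemma lpa_eq_sum_delta:
  assumes "finite I" "j \<in> I" "f j \<approx>\<^bsub>E\<^esub> g" "\<And>i. i \<in> I \<Longrightarrow> i \<noteq> j \<Longrightarrow> f i \<approx>\<^bsub>E\<^esub> 0"
  shows "(\<Sum>i \<in> I. f i) \<approx>\<^bsub>E\<^esub> g"
proof -
  have "(\<Sum>i \<in> I. f i) = f j + (\<Sum>i \<in> I - {j}. f i)"
    using assms by (simp add: sum.remove)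
  also have "\<dots> \<approx>\<^bsub>E\<^esub> g + 0"
    using assms by (intro lpa_eq_add lpa_eq_sum_zero) auto
  finally show ?thesis by simp
qed

text \<open>The shape taken by a product of two sums over exit paths: orthogonality leaves only the
  diagonal.\<close>

lemma lpa_eq_double_sum_delta:
  assumes "finite I" "\<And>i. i \<in> I \<Longrightarrow> f i i \<approx>\<^bsub>E\<^esub> g i"
    "\<And>i j. i \<in> I \<Longrightarrow> j \<in> I \<Longrightarrow> i \<noteq> j \<Longrightarrow> f i j \<approx>\<^bsub>E\<^esub> 0"
  shows "(\<Sum>i \<in> I. \<Sum>j \<in> I. f i j) \<approx>\<^bsub>E\<^esub> (\<Sum>i \<in> I. g i)"
  using assms by (intro lpa_eq_sum lpa_eq_sum_delta) auto

lemma lpa_eq_relator: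
  "p - q \<in> lpa_relators E \<Longrightarrow> p \<in> lpa_free E \<Longrightarrow> q \<in> lpa_free E \<Longrightarrow> p \<approx>\<^bsub>E\<^esub> q"
  by (simp add: lpa_eq_def presentation_rel_def generated_ideal.relator)

lemmas lpa_free_intros =
  free_algebra_zero free_algebra_gen free_algebra_mult free_algebra_sum

context wf_digraph
begin

section \<open>The defining relations (1) to (4) as congruences\<close>

lemma lpa_vert_vert:
  assumes "v \<in> verts G" "w \<in> verts G"
  shows "gen (Vert v) * gen (Vert w) \<approx>\<^bsub>G\<^esub> (if v = w then gen (Vert w) else 0)"
  using assms by (intro lpa_eq_relator) (auto simp: lpa_relators_def intro!: lpa_free_intros)

lemma lpa_vert_idem: "v \<in> verts G \<Longrightarrow> gen (Vert v) * gen (Vert v) \<approx>\<^bsub>G\<^esub> gen (Vert v)"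
  using lpa_vert_vert[of v v] by simp

lemma lpa_tail_edge: "e \<in> arcs G \<Longrightarrow> gen (Vert (tail G e)) * gen (Edge e) \<approx>\<^bsub>G\<^esub> gen (Edge e)"
  by (intro lpa_eq_relator) (auto simp: lpa_relators_def intro!: lpa_free_intros)

lemma lpa_edge_head: "e \<in> arcs G \<Longrightarrow> gen (Edge e) * gen (Vert (head G e)) \<approx>\<^bsub>G\<^esub> gen (Edge e)"
  by (intro lpa_eq_relator) (auto simp: lpa_relators_def intro!: lpa_free_intros)

lemma lpa_head_ghost: "e \<in> arcs G \<Longrightarrow> gen (Vert (head G e)) * gen (Ghost e) \<approx>\<^bsub>G\<^esub> gen (Ghost e)"
  by (intro lpa_eq_relator) (auto simp: lpa_relators_def intro!: lpa_free_intros)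

lemma lpa_ghost_tail: "e \<in> arcs G \<Longrightarrow> gen (Ghost e) * gen (Vert (tail G e)) \<approx>\<^bsub>G\<^esub> gen (Ghost e)"
  by (intro lpa_eq_relator) (auto simp: lpa_relators_def intro!: lpa_free_intros)

lemma lpa_ghost_edge:
  assumes "e \<in> arcs G" "f \<in> arcs G"
  shows "gen (Ghost e) * gen (Edge f) \<approx>\<^bsub>G\<^esub> (if e = f then gen (Vert (head G e)) else 0)"
  using assms by (intro lpa_eq_relator) (auto simp: lpa_relators_def intro!: lpa_free_intros)

lemma lpa_ghost_edge_same: "e \<in> arcs G \<Longrightarrow> gen (Ghost e) * gen (Edge e) \<approx>\<^bsub>G\<^esub> gen (Vert (head G e))"
  using lpa_ghost_edge[of e e] by simp

lemma lpa_ghost_edge_diff: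
  "e \<in> arcs G \<Longrightarrow> f \<in> arcs G \<Longrightarrow> e \<noteq> f \<Longrightarrow> gen (Ghost e) * gen (Edge f) \<approx>\<^bsub>G\<^esub> 0"
  using lpa_ghost_edge[of e f] by simp

lemma lpa_regular:
  assumes "regular_vertex G v"
  shows "gen (Vert v) \<approx>\<^bsub>G\<^esub> (\<Sum>e \<in> out_arcs G v. gen (Edge e) * gen (Ghost e))"
proof (rule lpa_eq_relator)
  show "gen (Vert v) - (\<Sum>e \<in> out_arcs G v. gen (Edge e) * gen (Ghost e)) \<in> lpa_relators G"
    using assms unfolding lpa_relators_def by blast
qed (use assms in \<open>auto simp: regular_vertex_def intro!: lpa_free_intros\<close>)

text \<open>Inserting v after a and w before b produces the product of two distinct
  vertices.\<close>

lemma lpa_mult_zero: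
  assumes "a * gen (Vert v) \<approx>\<^bsub>G\<^esub> a" "gen (Vert w) * b \<approx>\<^bsub>G\<^esub> b"
    "v \<in> verts G" "w \<in> verts G" "v \<noteq> w"
  shows "a * b \<approx>\<^bsub>G\<^esub> 0"
proof -
  have "a * b \<approx>\<^bsub>G\<^esub> (a * gen (Vert v)) * (gen (Vert w) * b)"
    using assms by (intro lpa_eq_mult) (auto intro: lpa_eq_sym)
  also have "\<dots> = a * (gen (Vert v) * gen (Vert w)) * b" by (simp add: mult.assoc)
  also have "\<dots> \<approx>\<^bsub>G\<^esub> a * 0 * b"
    using lpa_vert_vert[of v w] assms by (intro lpa_eq_mid) (auto dest: lpa_eq_free(2))
  finally show ?thesis by simp
qed

end

text \<open>Serves both directions: a map on generators respects the ideal as soon as its values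
  satisfy relations (1) to (4) up to congruence.\<close>

lemma lift_gens_lpa_relators:
  assumes vv: "\<And>v w. v \<in> verts G \<Longrightarrow> w \<in> verts G \<Longrightarrow>
      h (Vert v) * h (Vert w) \<approx>\<^bsub>E\<^esub> (if v = w then h (Vert w) else 0)"
    and te: "\<And>e. e \<in> arcs G \<Longrightarrow> h (Vert (tail G e)) * h (Edge e) \<approx>\<^bsub>E\<^esub> h (Edge e)"
    and eh: "\<And>e. e \<in> arcs G \<Longrightarrow> h (Edge e) * h (Vert (head G e)) \<approx>\<^bsub>E\<^esub> h (Edge e)"
    and hg: "\<And>e. e \<in> arcs G \<Longrightarrow> h (Vert (head G e)) * h (Ghost e) \<approx>\<^bsub>E\<^esub> h (Ghost e)"
    and gt: "\<And>e. e \<in> arcs G \<Longrightarrow> h (Ghost e) * h (Vert (tail G e)) \<approx>\<^bsub>E\<^esub> h (Ghost e)"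
    and ge: "\<And>e f. e \<in> arcs G \<Longrightarrow> f \<in> arcs G \<Longrightarrow>
      h (Ghost e) * h (Edge f) \<approx>\<^bsub>E\<^esub> (if e = f then h (Vert (head G e)) else 0)"
    and reg: "\<And>v. regular_vertex G v \<Longrightarrow>
      h (Vert v) \<approx>\<^bsub>E\<^esub> (\<Sum>e \<in> out_arcs G v. h (Edge e) * h (Ghost e))"
    and r: "r \<in> lpa_relators G"
  shows "lift_gens h r \<in> generated_ideal (lpa_gens E) (lpa_relators E)"
proof -
  have if_lift: "lift_gens h (if b then p else 0) = (if b then lift_gens h p else 0)" for b p
    by simp
  note lift = lift_gens_diff lift_gens_mult lift_gens_sum lift_gens_gen if_lift
  show ?thesis
    using r[unfolded lpa_relators_def]
    by (elim UnE CollectE exE conjE; simp only: lift)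
      (rule lpa_eq_ideal, rule vv te eh hg gt ge reg; assumption)+
qed

section \<open>Paths stopping in a hereditary set\<close>

text \<open>The set F_v of the overview, by recursion along the path and not by a condition on its
  last edge, so that induction on the path applies directly. It is matched with F(H) in
  \<open>entry_paths_Cons\<close>.\<close>

fun exit_path :: "('v, 'e) pre_digraph \<Rightarrow> 'v set \<Rightarrow> 'v \<Rightarrow> 'e list \<Rightarrow> bool" where
  "exit_path E H v [] \<longleftrightarrow> v \<in> H"
| "exit_path E H v (e # p) \<longleftrightarrow>
     v \<notin> H \<and> e \<in> arcs E \<and> tail E e = v \<and> exit_path E H (head E e) p"

text \<open>Unlike the head of \<open>last p\<close>, this is also meaningful for the empty path,
  where the end is v.\<close>

fun path_end :: "('v, 'e) pre_digraph \<Rightarrow> 'v \<Rightarrow> 'e list \<Rightarrow> 'v" where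
  "path_end E v [] = v"
| "path_end E v (e # p) = path_end E (head E e) p"

locale hereditary_lpa = wf_digraph E for E :: "('v, 'e) pre_digraph" +
  fixes H :: "'v set"
  assumes row_finite: "row_finite E"
    and hereditary: "hereditary E H"
    and fin_complement: "fin_digraph (complement_graph E H)"
    and acyclic_complement: "acyclic_graph (complement_graph E H)"
    and reaches_H: "\<forall>v \<in> verts E - H. connects_set E v H"
begin

lemma H_subset: "v \<in> H \<Longrightarrow> v \<in> verts E"
  using hereditary by (auto simp: hereditary_def)

lemma H_arc: "e \<in> arcs E \<Longrightarrow> tail E e \<in> H \<Longrightarrow> head E e \<in> H"
  \<comment> \<open>The edge \<open>Inl e\<close> of E(H) has head \<open>Inl (head E e)\<close>,
    and that this is a vertex of E(H) says exactly that it lies in H.\<close>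
  using wf_digraph_hereditary_graph[OF wf_digraph_axioms hereditary]
  by (auto simp: hereditary_graph_def wf_digraph_def)

definition exits :: "'v \<Rightarrow> 'e list set" where
  "exits v = {p. exit_path E H v p}"

lemma exits_H: "v \<in> H \<Longrightarrow> exits v = {[]}"
proof -
  assume "v \<in> H"
  then have "exit_path E H v p \<longleftrightarrow> p = []" for p by (cases p) auto
  then show ?thesis by (auto simp: exits_def)
qed

lemma exits_notin_H:
  assumes "v \<notin> H"
  shows "exits v = (\<Union>e \<in> out_arcs E v. (#) e ` exits (head E e))"
proof -
  have "exit_path E H v p \<longleftrightarrow> (\<exists>e q. p = e # q \<and> e \<in> out_arcs E v \<and> exit_path E H (head E e) q)" for p
    using assms by (cases p) auto
  then show ?thesis by (auto simp: exits_def)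
qed

text \<open>Together with row-finiteness this makes every vertex outside H regular, so that relation
  (4) is available there.\<close>

lemma out_arcs_nonempty:
  assumes "v \<in> verts E" "v \<notin> H"
  shows "out_arcs E v \<noteq> {}"
proof -
  obtain p w where "awalk v p w" "p \<noteq> []"
    using assms reaches_H unfolding connects_set_def connects_def path_between_def by blast
  then show ?thesis by (cases p) (auto simp: awalk_simps)
qed

section \<open>Induction backwards from H\<close>

text \<open>The relation is finite, and a loop in its transitive closure would be a closed walk of
  positive length outside H, which contains a cycle. Heads count as smaller than tails.\<close>

lemma wf_complement:
  "wf {(head E e, tail E e) | e. e \<in> arcs E \<and> head E e \<notin> H}" (is "wf ?r")
proof -
  let ?C = "complement_graph E H"
  interpret C: fin_digraph ?C by (rule fin_complement)
  have r: "?r = (\<lambda>e. (head E e, tail E e)) ` arcs ?C"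
    by (auto simp: complement_graph_def)
  \<comment> \<open>The pairs are reversed edges, so extending the chain at its right end prepends
    an edge to the walk.\<close>
  have walk: "\<exists>p. C.awalk v p w \<and> p \<noteq> []" if "(w, v) \<in> ?r\<^sup>+" for v w
    using that
  proof (induction rule: trancl_induct)
    case (base y)
    then obtain e where "e \<in> arcs ?C" "head ?C e = w" "tail ?C e = y"
      by (auto simp: complement_graph_def)
    then show ?case using C.arc_implies_awalk by blast
  next
    case (step y z)
    then obtain e p where e: "e \<in> arcs ?C" "head ?C e = y" "tail ?C e = z"
      and "C.awalk y p w" by (auto simp: complement_graph_def)
    then have "C.awalk z (e # p) w" by (simp add: C.awalk_Cons_iff)
    then show ?case by blast
  qed
  have "acyclic ?r"
  proof (rule acyclicI, intro allI notI)
    fix v assume "(v, v) \<in> ?r\<^sup>+"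
    from walk[OF this] obtain p where "C.closed_w p" by (auto simp: C.closed_w_def)
    then show False
      using C.closed_w_imp_cycle acyclic_complement by (auto simp: acyclic_graph_def)
  qed
  moreover have "finite ?r" unfolding r by simp
  ultimately show ?thesis using finite_acyclic_wf by blast
qed

lemma exit_induct [consumes 1, case_names H step]:
  assumes "v \<in> verts E"
    and inH: "\<And>v. v \<in> H \<Longrightarrow> P v"
    and step: "\<And>v. v \<in> verts E \<Longrightarrow> v \<notin> H \<Longrightarrow> (\<And>e. e \<in> out_arcs E v \<Longrightarrow> P (head E e)) \<Longrightarrow> P v"
  shows "P v"
  using wf_complement assms(1)
proof (induction v rule: wf_induct_rule)
  case (less v)
  show ?case
  proof (cases "v \<in> H")
    case False
    show ?thesis
    proof (rule step[OF less.prems False])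
      fix e assume "e \<in> out_arcs E v"
      then show "P (head E e)"
        \<comment> \<open>The well-founded relation only sees edges that stay outside H; edges
          entering H are served by the base case.\<close>
        using inH less.IH[of "head E e"] by (cases "head E e \<in> H") auto
    qed
  qed (rule inH)
qed

text \<open>Needed for every sum over F_v, since a sum over an infinite set would be 0 by
  convention.\<close>

lemma finite_exits: "v \<in> verts E \<Longrightarrow> finite (exits v)"
proof (induction v rule: exit_induct)
  case (step v)
  then show ?case using row_finite by (auto simp: exits_notin_H row_finite_def)
qed (simp add: exits_H)

text \<open>F(H) restricts only the last edge of a path. Heredity does the rest: an edge with source
  in H has its range in H, so if a later source lies outside H, all earlier ones do too.\<close>

lemma entry_paths_Cons:
  "e # p \<in> entry_paths E H \<longleftrightarrow> e \<in> arcs E \<and> tail E e \<notin> H \<and> exit_path E H (head E e) p"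
proof (induction p arbitrary: e)
  case Nil
  have "is_path E [e] \<longleftrightarrow> e \<in> arcs E"
    using arc_implies_awalk by (auto simp: is_path_def path_between_def awalk_Cons_iff)
  then show ?case by (auto simp: entry_paths_def)
next
  case (Cons f p)
  have "is_path E (e # f # p) \<longleftrightarrow> e \<in> arcs E \<and> tail E f = head E e \<and> is_path E (f # p)"
    by (auto simp: is_path_def path_between_def awalk_simps)
  then have "e # f # p \<in> entry_paths E H \<longleftrightarrow>
      e \<in> arcs E \<and> tail E f = head E e \<and> f # p \<in> entry_paths E H"
    by (auto simp: entry_paths_def)
  then show ?case using H_arc by (auto simp: Cons.IH)
qed

lemma Nil_notin_entry_paths [simp]: "[] \<notin> entry_paths E H"
  by (simp add: entry_paths_def is_path_def path_between_def)

lemma entry_paths_cases: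
  assumes "\<alpha> \<in> entry_paths E H"
  obtains e p where "\<alpha> = e # p" "e \<in> arcs E" "tail E e \<notin> H" "exit_path E H (head E e) p"
  using assms by (cases \<alpha>) (auto simp: entry_paths_Cons)

lemma exit_path_entry_path: "exit_path E H v p \<Longrightarrow> p \<noteq> [] \<Longrightarrow> p \<in> entry_paths E H"
  by (cases p) (auto simp: entry_paths_Cons)

lemma path_end_last: "p \<noteq> [] \<Longrightarrow> path_end E v p = head E (last p)"
  by (induction p arbitrary: v rule: list_nonempty_induct) auto

lemma exit_path_vert: "exit_path E H v p \<Longrightarrow> v \<in> verts E"
  by (cases p) (auto simp: H_subset)

lemma entry_path_exit: "\<alpha> \<in> entry_paths E H \<Longrightarrow> exit_path E H (tail E (hd \<alpha>)) \<alpha>"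
  by (auto elim: entry_paths_cases)

end

section \<open>From $L_K(E(H))$ to $L_K(E)$\<close>

text \<open>The vertex argument only matters for the empty path.\<close>

fun path_elt :: "('v, 'e) pre_digraph \<Rightarrow> 'v \<Rightarrow> 'e list \<Rightarrow> (('v, 'e) lpa_gen, 'k::field) free_poly"
where
  "path_elt E v [] = gen (Vert v)"
| "path_elt E v (e # p) = gen (Edge e) * path_elt E (head E e) p"

fun ghost_elt :: "('v, 'e) pre_digraph \<Rightarrow> 'v \<Rightarrow> 'e list \<Rightarrow> (('v, 'e) lpa_gen, 'k::field) free_poly"
where
  "ghost_elt E v [] = gen (Vert v)"
| "ghost_elt E v (e # p) = ghost_elt E (head E e) p * gen (Ghost e)"

text \<open>Elements of F(H) are nonempty, so \<open>tail E (hd \<alpha>)\<close> recovers the start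
  vertex, which E(H) does not record.\<close>

fun unfold_gen ::
  "('v, 'e) pre_digraph \<Rightarrow> ('v + 'e list, 'e + 'e list) lpa_gen \<Rightarrow> (('v, 'e) lpa_gen, 'k::field) free_poly"
where
  "unfold_gen E (Vert (Inl v)) = gen (Vert v)"
| "unfold_gen E (Vert (Inr \<alpha>)) = path_elt E (tail E (hd \<alpha>)) \<alpha> * ghost_elt E (tail E (hd \<alpha>)) \<alpha>"
| "unfold_gen E (Edge (Inl e)) = gen (Edge e)"
| "unfold_gen E (Edge (Inr \<alpha>)) = path_elt E (tail E (hd \<alpha>)) \<alpha>"
| "unfold_gen E (Ghost (Inl e)) = gen (Ghost e)"
| "unfold_gen E (Ghost (Inr \<alpha>)) = ghost_elt E (tail E (hd \<alpha>)) \<alpha>"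

context hereditary_lpa
begin

abbreviation EH where "EH \<equiv> hereditary_graph E H"

lemma EH_simps [simp]:
  "Inl v \<in> verts EH \<longleftrightarrow> v \<in> H" "Inr \<alpha> \<in> verts EH \<longleftrightarrow> \<alpha> \<in> entry_paths E H"
  "Inl e \<in> arcs EH \<longleftrightarrow> e \<in> arcs E \<and> tail E e \<in> H" "Inr \<alpha> \<in> arcs EH \<longleftrightarrow> \<alpha> \<in> entry_paths E H"
  "tail EH (Inl e) = Inl (tail E e)" "tail EH (Inr \<alpha>) = Inr \<alpha>"
  "head EH (Inl e) = Inl (head E e)" "head EH (Inr \<alpha>) = Inl (head E (last \<alpha>))"
  by (auto simp: hereditary_graph_def)

lemma out_arcs_EH_Inl: "v \<in> H \<Longrightarrow> out_arcs EH (Inl v) = Inl ` out_arcs E v"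
  by (auto simp: hereditary_graph_def)

lemma out_arcs_EH_Inr: "\<alpha> \<in> entry_paths E H \<Longrightarrow> out_arcs EH (Inr \<alpha>) = {Inr \<alpha>}"
  by (auto simp: hereditary_graph_def)

lemma regular_vertex_EH_Inl: "v \<in> H \<Longrightarrow> regular_vertex EH (Inl v) \<longleftrightarrow> regular_vertex E v"
  using H_subset by (auto simp: regular_vertex_def out_arcs_EH_Inl finite_image_iff)

section \<open>Paths and their ghosts in the algebra of E: orthogonality and the decomposition of a
  vertex\<close>

lemma path_elt_free [intro]: "exit_path E H v p \<Longrightarrow> path_elt E v p \<in> lpa_free E"
  by (induction p arbitrary: v) (auto intro!: lpa_free_intros simp: H_subset)

lemma ghost_elt_free [intro]: "exit_path E H v p \<Longrightarrow> ghost_elt E v p \<in> lpa_free E"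
  by (induction p arbitrary: v) (auto intro!: lpa_free_intros simp: H_subset)

lemma vert_path_elt: "exit_path E H v p \<Longrightarrow> gen (Vert v) * path_elt E v p \<approx>\<^bsub>E\<^esub> path_elt E v p"
  by (cases p) (auto simp: H_subset lpa_vert_idem simp flip: mult.assoc
      intro!: lpa_eq_right lpa_tail_edge)

lemma ghost_elt_vert: "exit_path E H v p \<Longrightarrow> ghost_elt E v p * gen (Vert v) \<approx>\<^bsub>E\<^esub> ghost_elt E v p"
  by (cases p) (auto simp: H_subset lpa_vert_idem mult.assoc
      intro!: lpa_eq_left lpa_ghost_tail)

lemma path_elt_end:
  "exit_path E H v p \<Longrightarrow> path_elt E v p * gen (Vert (path_end E v p)) \<approx>\<^bsub>E\<^esub> path_elt E v p"
  by (induction p arbitrary: v)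
    (auto simp: H_subset lpa_vert_idem mult.assoc intro!: lpa_eq_left lpa_free_intros)

lemma end_ghost_elt:
  "exit_path E H v p \<Longrightarrow> gen (Vert (path_end E v p)) * ghost_elt E v p \<approx>\<^bsub>E\<^esub> ghost_elt E v p"
  by (induction p arbitrary: v)
    (auto simp: H_subset lpa_vert_idem simp flip: mult.assoc intro!: lpa_eq_right lpa_free_intros)

lemma ghost_path_Cons:
  assumes "e \<in> arcs E" "exit_path E H (head E e) p" "exit_path E H (head E e) q"
  shows "ghost_elt E v (e # p) * path_elt E v (e # q) \<approx>\<^bsub>E\<^esub> ghost_elt E (head E e) p * path_elt E (head E e) q"
proof -
  have "ghost_elt E v (e # p) * path_elt E v (e # q)
      = ghost_elt E (head E e) p * (gen (Ghost e) * gen (Edge e)) * path_elt E (head E e) q"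
    by (simp add: mult.assoc)
  also have "\<dots> \<approx>\<^bsub>E\<^esub> ghost_elt E (head E e) p * gen (Vert (head E e)) * path_elt E (head E e) q"
    using assms by (intro lpa_eq_mid lpa_ghost_edge_same) auto
  also have "\<dots> \<approx>\<^bsub>E\<^esub> ghost_elt E (head E e) p * path_elt E (head E e) q"
    using assms by (intro lpa_eq_right ghost_elt_vert) auto
  finally show ?thesis .
qed

lemma ghost_path_same:
  "exit_path E H v p \<Longrightarrow> ghost_elt E v p * path_elt E v p
     \<approx>\<^bsub>E\<^esub> (gen (Vert (path_end E v p)) :: ('v, 'e, 'k::field) lpa_poly)"
proof (induction p arbitrary: v)
  case Nil
  then show ?case by (simp add: H_subset lpa_vert_idem)
next
  case (Cons e p)
  then have "ghost_elt E v (e # p) * path_elt E v (e # p)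
      \<approx>\<^bsub>E\<^esub> (ghost_elt E (head E e) p * path_elt E (head E e) p :: ('v, 'e, 'k) lpa_poly)"
    by (intro ghost_path_Cons) auto
  also have "\<dots> \<approx>\<^bsub>E\<^esub> gen (Vert (path_end E v (e # p)))"
    using Cons by simp
  finally show ?case .
qed

text \<open>Common first edges cancel until the paths diverge, where e^*f = 0. Neither path can stop
  before that: it would stop at a vertex of H, where the other path has to stop as well.\<close>

lemma ghost_path_diff:
  "exit_path E H v p \<Longrightarrow> exit_path E H v q \<Longrightarrow> p \<noteq> q \<Longrightarrow>
     ghost_elt E v p * path_elt E v q \<approx>\<^bsub>E\<^esub> (0 :: ('v, 'e, 'k::field) lpa_poly)"
proof (induction p arbitrary: v q)
  case Nil
  then show ?case by (cases q) auto
next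
  case (Cons e p)
  then obtain f q' where q: "q = f # q'" "f \<in> arcs E" "tail E f = v" "exit_path E H (head E f) q'"
    by (cases q) auto
  show ?case
  proof (cases "e = f")
    case True
    have "ghost_elt E v (e # p) * path_elt E v q
        \<approx>\<^bsub>E\<^esub> (ghost_elt E (head E e) p * path_elt E (head E e) q' :: ('v, 'e, 'k) lpa_poly)"
      unfolding \<open>q = _\<close> True[symmetric] using q Cons.prems True by (intro ghost_path_Cons) auto
    also have "\<dots> \<approx>\<^bsub>E\<^esub> 0"
      using q Cons True by (intro Cons.IH) auto
    finally show ?thesis .
  next
    case False
    have "ghost_elt E v (e # p) * path_elt E v q
      = (ghost_elt E (head E e) p * (gen (Ghost e) * gen (Edge f)) * path_elt E (head E f) q'
          :: ('v, 'e, 'k) lpa_poly)"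
      by (simp add: q mult.assoc)
    also have "\<dots> \<approx>\<^bsub>E\<^esub> ghost_elt E (head E e) p * 0 * path_elt E (head E f) q'"
      using q Cons.prems False by (intro lpa_eq_mid lpa_ghost_edge_diff) auto
    finally show ?thesis by simp
  qed
qed

text \<open>Paths with the same source are compared edge by edge; paths with different sources are
  separated by the orthogonal source vertices.\<close>

lemma ghost_path_entry:
  assumes "\<alpha> \<in> entry_paths E H" "\<beta> \<in> entry_paths E H"
  shows "ghost_elt E (tail E (hd \<alpha>)) \<alpha> * path_elt E (tail E (hd \<beta>)) \<beta>
    \<approx>\<^bsub>E\<^esub> (if \<alpha> = \<beta> then gen (Vert (head E (last \<alpha>))) else 0)"
proof -
  let ?v = "tail E (hd \<alpha>)" and ?w = "tail E (hd \<beta>)"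
  note \<alpha> = entry_path_exit[OF assms(1)] and \<beta> = entry_path_exit[OF assms(2)]
  consider "\<alpha> = \<beta>" | "\<alpha> \<noteq> \<beta>" "?v = ?w" | "\<alpha> \<noteq> \<beta>" "?v \<noteq> ?w" by blast
  then show ?thesis
  proof cases
    case 1
    have "path_end E ?v \<alpha> = head E (last \<alpha>)" using assms by (intro path_end_last) auto
    then show ?thesis using 1 ghost_path_same[OF \<alpha>] by simp
  next
    case 2
    then show ?thesis using ghost_path_diff[OF \<alpha>, of \<beta>] \<beta> by simp
  next
    case 3
    then show ?thesis
      using lpa_mult_zero[OF ghost_elt_vert[OF \<alpha>] vert_path_elt[OF \<beta>]] \<alpha> \<beta>
      by (simp add: exit_path_vert)
  qed
qed

text \<open>Grouping the paths by their first edge e, the inner sum is r(e) by induction, and what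
  remains is the right side of relation (4) at v.\<close>

lemma sum_path_ghost:
  "v \<in> verts E \<Longrightarrow>
     (\<Sum>p \<in> exits v. path_elt E v p * ghost_elt E v p) \<approx>\<^bsub>E\<^esub> (gen (Vert v) :: ('v, 'e, 'k::field) lpa_poly)"
proof (induction v rule: exit_induct)
  case (H v)
  then show ?case by (simp add: exits_H lpa_vert_idem H_subset)
next
  case (step v)
  have fin: "finite (out_arcs E v)" using step row_finite by (auto simp: row_finite_def)
  have "(\<Sum>p \<in> exits v. path_elt E v p * ghost_elt E v p :: ('v, 'e, 'k) lpa_poly)
      = (\<Sum>e \<in> out_arcs E v. \<Sum>p \<in> (#) e ` exits (head E e). path_elt E v p * ghost_elt E v p)"
    unfolding exits_notin_H[OF step(2)]
    using fin by (intro sum.UNION_disjoint) (auto simp: finite_exits)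
  also have "\<dots> = (\<Sum>e \<in> out_arcs E v. gen (Edge e) *
      (\<Sum>p \<in> exits (head E e). path_elt E (head E e) p * ghost_elt E (head E e) p) * gen (Ghost e))"
    by (intro sum.cong refl, subst sum.reindex)
      (auto simp: sum_distrib_left sum_distrib_right mult.assoc)
  also have "\<dots> \<approx>\<^bsub>E\<^esub> (\<Sum>e \<in> out_arcs E v. gen (Edge e) * gen (Vert (head E e)) * gen (Ghost e))"
    using step by (intro lpa_eq_sum lpa_eq_mid step.IH) (auto intro!: lpa_free_intros)
  also have "\<dots> \<approx>\<^bsub>E\<^esub> (\<Sum>e \<in> out_arcs E v. gen (Edge e) * gen (Ghost e))"
    by (intro lpa_eq_sum lpa_eq_right lpa_edge_head) (auto intro!: lpa_free_intros)
  also have "\<dots> \<approx>\<^bsub>E\<^esub> gen (Vert v)"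
    using step fin out_arcs_nonempty[of v]
    by (intro lpa_eq_sym[OF lpa_regular]) (auto simp: regular_vertex_def)
  finally show ?case .
qed

lemma unfold_gen_free:
  assumes "x \<in> lpa_gens EH"
  shows "unfold_gen E x \<in> lpa_free E"
  using assms
  by (cases x; cases "(E, x)" rule: unfold_gen.cases)
    (simp_all add: free_algebra_gen free_algebra_mult path_elt_free ghost_elt_free
      entry_path_exit H_subset)

lemma tail_hd_entry:
  assumes "\<alpha> \<in> entry_paths E H"
  shows "tail E (hd \<alpha>) \<in> verts E" "tail E (hd \<alpha>) \<notin> H"
  using assms by (auto elim: entry_paths_cases)

text \<open>Writing P and G for a path and its ghost, everything rests on \<open>GP\<close>. It
  yields PGP = P and GPG = G, so PG is an idempotent that can play the vertex. \<open>zeroP\<close>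
  and \<open>Gzero\<close> remove products that mix F(H) with H, because entry paths start outside
  H.\<close>

lemma unfold_gen_relators:
  assumes "r \<in> lpa_relators EH"
  shows "(lift_gens (unfold_gen E) r :: ('v, 'e, 'k::field) lpa_poly) \<in> generated_ideal (lpa_gens E) (lpa_relators E)"
proof (rule lift_gens_lpa_relators[OF _ _ _ _ _ _ _ assms])
  define P G where "P \<alpha> = (path_elt E (tail E (hd \<alpha>)) \<alpha> :: ('v, 'e, 'k) lpa_poly)"
    and "G \<alpha> = (ghost_elt E (tail E (hd \<alpha>)) \<alpha> :: ('v, 'e, 'k) lpa_poly)" for \<alpha>
  let ?F = "entry_paths E H"
  have PG_free: "P \<alpha> \<in> lpa_free E" "G \<alpha> \<in> lpa_free E" if "\<alpha> \<in> ?F" for \<alpha>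
    using that by (auto simp: P_def G_def entry_path_exit)
  have VP: "gen (Vert (tail E (hd \<alpha>))) * P \<alpha> \<approx>\<^bsub>E\<^esub> P \<alpha>" if "\<alpha> \<in> ?F" for \<alpha>
    using that by (auto simp: P_def entry_path_exit vert_path_elt)
  have GV: "G \<alpha> * gen (Vert (tail E (hd \<alpha>))) \<approx>\<^bsub>E\<^esub> G \<alpha>" if "\<alpha> \<in> ?F" for \<alpha>
    using that by (auto simp: G_def entry_path_exit ghost_elt_vert)
  have path_end: "path_end E (tail E (hd \<alpha>)) \<alpha> = head E (last \<alpha>)" if "\<alpha> \<in> ?F" for \<alpha>
    using that by (intro path_end_last) auto
  have PV: "P \<alpha> * gen (Vert (head E (last \<alpha>))) \<approx>\<^bsub>E\<^esub> P \<alpha>" if "\<alpha> \<in> ?F" for \<alpha>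
    using path_elt_end[OF entry_path_exit[OF that]] that by (simp add: P_def path_end)
  have VG: "gen (Vert (head E (last \<alpha>))) * G \<alpha> \<approx>\<^bsub>E\<^esub> G \<alpha>" if "\<alpha> \<in> ?F" for \<alpha>
    using end_ghost_elt[OF entry_path_exit[OF that]] that by (simp add: G_def path_end)
  have GP: "G \<alpha> * P \<beta> \<approx>\<^bsub>E\<^esub> (if \<alpha> = \<beta> then gen (Vert (head E (last \<alpha>))) else 0)"
    if "\<alpha> \<in> ?F" "\<beta> \<in> ?F" for \<alpha> \<beta>
    using ghost_path_entry[OF that] by (simp add: P_def G_def)
  have PGP: "P \<alpha> * G \<alpha> * P \<beta> \<approx>\<^bsub>E\<^esub> (if \<alpha> = \<beta> then P \<beta> else 0)" if "\<alpha> \<in> ?F" "\<beta> \<in> ?F" for \<alpha> \<beta>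
  proof -
    have "P \<alpha> * (G \<alpha> * P \<beta>) \<approx>\<^bsub>E\<^esub> P \<alpha> * (if \<alpha> = \<beta> then gen (Vert (head E (last \<alpha>))) else 0)"
      using that by (intro lpa_eq_left GP PG_free)
    also have "\<dots> \<approx>\<^bsub>E\<^esub> (if \<alpha> = \<beta> then P \<beta> else 0)"
      using PV that by (auto intro: lpa_eq_refl free_algebra_zero)
    finally show ?thesis by (simp add: mult.assoc)
  qed
  have GPG: "G \<alpha> * (P \<alpha> * G \<alpha>) \<approx>\<^bsub>E\<^esub> G \<alpha>" if "\<alpha> \<in> ?F" for \<alpha>
  proof -
    have "G \<alpha> * P \<alpha> * G \<alpha> \<approx>\<^bsub>E\<^esub> gen (Vert (head E (last \<alpha>))) * G \<alpha>"
      using GP[of \<alpha> \<alpha>] that by (intro lpa_eq_right PG_free) auto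
    also have "\<dots> \<approx>\<^bsub>E\<^esub> G \<alpha>" using that by (rule VG)
    finally show ?thesis by (simp add: mult.assoc)
  qed
  have zeroP: "a * P \<alpha> \<approx>\<^bsub>E\<^esub> 0" if "a * gen (Vert v) \<approx>\<^bsub>E\<^esub> a" "v \<in> H" "\<alpha> \<in> ?F" for a v \<alpha>
    using that lpa_mult_zero[OF that(1) VP[OF that(3)]] tail_hd_entry[of \<alpha>] H_subset[of v] by auto
  have Gzero: "G \<alpha> * a \<approx>\<^bsub>E\<^esub> 0" if "gen (Vert v) * a \<approx>\<^bsub>E\<^esub> a" "v \<in> H" "\<alpha> \<in> ?F" for a v \<alpha>
    using that lpa_mult_zero[OF GV[OF that(3)] that(1)] tail_hd_entry[of \<alpha>] H_subset[of v] by auto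
  have \<phi>: "unfold_gen E (Vert (Inr \<alpha>)) = P \<alpha> * G \<alpha>" "unfold_gen E (Edge (Inr \<alpha>)) = P \<alpha>"
    "unfold_gen E (Ghost (Inr \<alpha>)) = G \<alpha>" for \<alpha>
    by (simp_all add: P_def G_def)
  \<comment> \<open>P and G become opaque, so that simplification does not unfold the paths any
    more.\<close>
  note [simp] = \<phi>
  note [simp del] = unfold_gen.simps(2,4,6)
  show "unfold_gen E (Vert x) * unfold_gen E (Vert y)
      \<approx>\<^bsub>E\<^esub> (if x = y then unfold_gen E (Vert y) else (0 :: ('v, 'e, 'k) lpa_poly))"
    if "x \<in> verts EH" "y \<in> verts EH" for x y
  proof (cases x)
    case (Inl v)
    show ?thesis
    proof (cases y)
      case (Inl w)
      then show ?thesis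
        using lpa_vert_vert[of v w] that \<open>x = _\<close> by (cases "v = w") (simp_all add: H_subset)
    next
      case (Inr \<beta>)
      have "gen (Vert v) * P \<beta> * G \<beta> \<approx>\<^bsub>E\<^esub> 0 * G \<beta>"
        using that \<open>x = _\<close> Inr by (intro lpa_eq_right zeroP[of _ v] lpa_vert_idem PG_free) (auto simp: H_subset)
      then show ?thesis using Inl Inr by (simp add: mult.assoc)
    qed
  next
    case (Inr \<alpha>)
    show ?thesis
    proof (cases y)
      case (Inl w)
      have "P \<alpha> * (G \<alpha> * gen (Vert w)) \<approx>\<^bsub>E\<^esub> P \<alpha> * 0"
        using that \<open>x = _\<close> Inl by (intro lpa_eq_left Gzero[of w] lpa_vert_idem PG_free) (auto simp: H_subset)
      then show ?thesis using Inl Inr by (simp add: mult.assoc)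
    next
      case (Inr \<beta>)
      have "P \<alpha> * G \<alpha> * P \<beta> * G \<beta> \<approx>\<^bsub>E\<^esub> (if \<alpha> = \<beta> then P \<beta> else 0) * G \<beta>"
        using that \<open>x = _\<close> Inr by (intro lpa_eq_right PGP PG_free) auto
      moreover have "\<dots> = (if \<alpha> = \<beta> then P \<beta> * G \<beta> else 0)" by simp
      ultimately show ?thesis using \<open>x = _\<close> Inr by (simp only: mult.assoc \<phi> sum.inject)
    qed
  qed
  \<comment> \<open>The source of the edge \<open>Inr \<alpha>\<close> is the vertex \<alpha>,
    represented by PG; so this relation is PGP = P, and its dual below is GPG = G.\<close>
  show "unfold_gen E (Vert (tail EH e)) * unfold_gen E (Edge e)
      \<approx>\<^bsub>E\<^esub> (unfold_gen E (Edge e) :: ('v, 'e, 'k) lpa_poly)" if "e \<in> arcs EH" for e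
    using that PGP[of "projr e" "projr e"] by (cases e) (auto simp: lpa_tail_edge)
  show "unfold_gen E (Edge e) * unfold_gen E (Vert (head EH e))
      \<approx>\<^bsub>E\<^esub> (unfold_gen E (Edge e) :: ('v, 'e, 'k) lpa_poly)" if "e \<in> arcs EH" for e
    using that PV by (cases e) (auto simp: lpa_edge_head)
  show "unfold_gen E (Vert (head EH e)) * unfold_gen E (Ghost e)
      \<approx>\<^bsub>E\<^esub> (unfold_gen E (Ghost e) :: ('v, 'e, 'k) lpa_poly)" if "e \<in> arcs EH" for e
    using that VG by (cases e) (auto simp: lpa_head_ghost)
  show "unfold_gen E (Ghost e) * unfold_gen E (Vert (tail EH e))
      \<approx>\<^bsub>E\<^esub> (unfold_gen E (Ghost e) :: ('v, 'e, 'k) lpa_poly)" if "e \<in> arcs EH" for e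
    using that GPG by (cases e) (auto simp: lpa_ghost_tail)
  show "unfold_gen E (Ghost e) * unfold_gen E (Edge f)
      \<approx>\<^bsub>E\<^esub> (if e = f then unfold_gen E (Vert (head EH e)) else (0 :: ('v, 'e, 'k) lpa_poly))"
    if "e \<in> arcs EH" "f \<in> arcs EH" for e f
  proof (cases e)
    case (Inl e')
    then show ?thesis
      using that zeroP[OF lpa_ghost_tail[of e']]
      by (cases f) (auto simp: lpa_ghost_edge_same lpa_ghost_edge_diff)
  next
    case (Inr \<alpha>)
    then show ?thesis
      using that GP[of \<alpha> "projr f"] Gzero[OF lpa_tail_edge] by (cases f) (auto split: if_splits)
  qed
  show "unfold_gen E (Vert x) \<approx>\<^bsub>E\<^esub>
      ((\<Sum>e \<in> out_arcs EH x. unfold_gen E (Edge e) * unfold_gen E (Ghost e)) :: ('v, 'e, 'k) lpa_poly)"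
    if x: "regular_vertex EH x" for x
  proof (cases x)
    case (Inl v)
    then have "v \<in> H" using x by (simp add: regular_vertex_def)
    then show ?thesis using x Inl lpa_regular[of v]
      by (simp add: regular_vertex_EH_Inl out_arcs_EH_Inl sum.reindex)
  next
    case (Inr \<alpha>)
    then have "\<alpha> \<in> ?F" using x by (simp add: regular_vertex_def)
    then show ?thesis using Inr PG_free
      by (simp add: out_arcs_EH_Inr lpa_eq_refl free_algebra_mult)
  qed
qed

end

section \<open>From $L_K(E)$ to $L_K(E(H))$\<close>

context hereditary_lpa
begin

sublocale EH: wf_digraph EH
  by (rule wf_digraph_hereditary_graph[OF wf_digraph_axioms hereditary])

definition exit_vert :: "'v \<Rightarrow> 'e list \<Rightarrow> 'v + 'e list" where
  "exit_vert v p = (if p = [] then Inl v else Inr p)"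

text \<open>For the empty path the vertex v of H serves as its own edge and, in
  \<open>exit_ghost\<close>, as its own ghost. Being idempotent, it obeys the same rules as a
  genuine pair.\<close>

definition exit_edge :: "'v \<Rightarrow> 'e list \<Rightarrow> ('v + 'e list, 'e + 'e list, 'k::field) lpa_poly" where
  "exit_edge v p = gen (if p = [] then Vert (Inl v) else Edge (Inr p))"

definition exit_ghost :: "'v \<Rightarrow> 'e list \<Rightarrow> ('v + 'e list, 'e + 'e list, 'k::field) lpa_poly" where
  "exit_ghost v p = gen (if p = [] then Vert (Inl v) else Ghost (Inr p))"

definition exit_sum :: "'v \<Rightarrow> ('v + 'e list, 'e + 'e list, 'k::field) lpa_poly" where
  "exit_sum v = (\<Sum>p \<in> exits v. gen (Vert (exit_vert v p)))"

text \<open>The path \<open>e # p\<close> is never empty, so its factor is always a genuine edge or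
  ghost of E(H); the default can occur only in the factor for p, namely when the range of e lies in
  H.\<close>

fun fold_gen :: "('v, 'e) lpa_gen \<Rightarrow> ('v + 'e list, 'e + 'e list, 'k::field) lpa_poly" where
  "fold_gen (Vert v) = exit_sum v"
| "fold_gen (Edge e) = (if tail E e \<in> H then gen (Edge (Inl e))
     else \<Sum>p \<in> exits (head E e). exit_edge (tail E e) (e # p) * exit_ghost (head E e) p)"
| "fold_gen (Ghost e) = (if tail E e \<in> H then gen (Ghost (Inl e))
     else \<Sum>p \<in> exits (head E e). exit_edge (head E e) p * exit_ghost (tail E e) (e # p))"

section \<open>Calculation rules for exit paths in the algebra of E(H)\<close>

lemma exits_path: "p \<in> exits v \<longleftrightarrow> exit_path E H v p"
  by (simp add: exits_def)

lemma exit_sum_H: "v \<in> H \<Longrightarrow> exit_sum v = gen (Vert (Inl v))"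
  by (simp add: exit_sum_def exits_H exit_vert_def)

lemma exit_vert_in [simp]: "exit_path E H v p \<Longrightarrow> exit_vert v p \<in> verts EH"
  by (auto simp: exit_vert_def exit_path_entry_path)

text \<open>A nonempty exit path determines its start as the tail of its first edge; an empty one
  carries the start in \<open>Inl\<close>. Hence different pairs give orthogonal vertices of
  E(H).\<close>

lemma exit_vert_inj:
  assumes "exit_path E H v p" "exit_path E H w q" "exit_vert v p = exit_vert w q"
  shows "v = w" "p = q"
  using assms by (cases p; cases q; auto simp: exit_vert_def)+

lemma exit_edge_free [simp]: "exit_path E H v p \<Longrightarrow> exit_edge v p \<in> lpa_free EH"
  by (auto simp: exit_edge_def exit_path_entry_path intro!: free_algebra_gen)

lemma exit_ghost_free [simp]: "exit_path E H v p \<Longrightarrow> exit_ghost v p \<in> lpa_free EH"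
  by (auto simp: exit_ghost_def exit_path_entry_path intro!: free_algebra_gen)

lemma vert_exit_edge:
  "exit_path E H v p \<Longrightarrow> gen (Vert (exit_vert v p)) * exit_edge v p \<approx>\<^bsub>EH\<^esub> exit_edge v p"
  using EH.lpa_tail_edge[of "Inr p"] EH.lpa_vert_idem[of "Inl v"]
  by (auto simp: exit_edge_def exit_vert_def exit_path_entry_path)

lemma exit_ghost_vert:
  "exit_path E H v p \<Longrightarrow> exit_ghost v p * gen (Vert (exit_vert v p)) \<approx>\<^bsub>EH\<^esub> exit_ghost v p"
  using EH.lpa_ghost_tail[of "Inr p"] EH.lpa_vert_idem[of "Inl v"]
  by (auto simp: exit_ghost_def exit_vert_def exit_path_entry_path)

lemma exit_edge_end:
  "exit_path E H v p \<Longrightarrow> exit_edge v p * gen (Vert (Inl (path_end E v p))) \<approx>\<^bsub>EH\<^esub> exit_edge v p"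
  using EH.lpa_edge_head[of "Inr p"] EH.lpa_vert_idem[of "Inl v"]
  by (auto simp: exit_edge_def exit_path_entry_path path_end_last)

lemma end_exit_ghost:
  "exit_path E H v p \<Longrightarrow> gen (Vert (Inl (path_end E v p))) * exit_ghost v p \<approx>\<^bsub>EH\<^esub> exit_ghost v p"
  using EH.lpa_head_ghost[of "Inr p"] EH.lpa_vert_idem[of "Inl v"]
  by (auto simp: exit_ghost_def exit_path_entry_path path_end_last)

lemma exit_ghost_edge_same:
  "exit_path E H v p \<Longrightarrow> exit_ghost v p * exit_edge v p \<approx>\<^bsub>EH\<^esub> gen (Vert (Inl (path_end E v p)))"
  using EH.lpa_ghost_edge_same[of "Inr p"] EH.lpa_vert_idem[of "Inl v"]
  by (auto simp: exit_ghost_def exit_edge_def exit_path_entry_path path_end_last)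

lemma exit_ghost_edge_diff:
  assumes "exit_path E H v p" "exit_path E H w q" "p \<noteq> q" "v = w \<or> p \<noteq> [] \<and> q \<noteq> []"
  shows "exit_ghost v p * exit_edge w q \<approx>\<^bsub>EH\<^esub> 0"
proof -
  \<comment> \<open>With a common start, one empty path puts the start in H, where it is the only
    exit path; so distinct paths are both nonempty.\<close>
  have "p \<noteq> []" "q \<noteq> []" using assms by (cases p; cases q; auto)+
  then show ?thesis
    using assms EH.lpa_ghost_edge_diff[of "Inr p" "Inr q"]
    by (auto simp: exit_ghost_def exit_edge_def exit_path_entry_path)
qed

text \<open>For nonempty p this is relation (4) at the vertex \<open>Inr p\<close>, which emits a
  single edge; for empty p it is idempotency of v.\<close>

lemma exit_edge_ghost:
  assumes "exit_path E H v p"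
  shows "exit_edge v p * exit_ghost v p \<approx>\<^bsub>EH\<^esub> gen (Vert (exit_vert v p))"
proof (cases "p = []")
  case True
  then show ?thesis
    using assms EH.lpa_vert_idem[of "Inl v"]
    by (simp add: exit_edge_def exit_ghost_def exit_vert_def)
next
  case False
  with assms have p: "p \<in> entry_paths E H" by (rule exit_path_entry_path)
  then have "regular_vertex EH (Inr p)"
    by (simp add: regular_vertex_def out_arcs_EH_Inr)
  from EH.lpa_regular[OF this, THEN lpa_eq_sym] show ?thesis
    using False p by (simp add: exit_edge_def exit_ghost_def exit_vert_def out_arcs_EH_Inr)
qed

lemma exit_sum_free [simp]: "exit_sum v \<in> lpa_free EH"
  by (auto simp: exit_sum_def exits_path intro!: lpa_free_intros)

lemma exit_sum_vert:
  assumes "v \<in> verts E" "exit_path E H w q"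
  shows "exit_sum v * gen (Vert (exit_vert w q))
    \<approx>\<^bsub>EH\<^esub> (if v = w then gen (Vert (exit_vert w q)) else 0)"
proof -
  have diff: "gen (Vert (exit_vert v p)) * gen (Vert (exit_vert w q)) \<approx>\<^bsub>EH\<^esub> 0"
    if "p \<in> exits v" "v \<noteq> w \<or> p \<noteq> q" for p
  proof -
    have "exit_vert v p \<noteq> exit_vert w q"
      using exit_vert_inj[of v p w q] that assms(2) by (auto simp: exits_path)
    then show ?thesis
      using EH.lpa_vert_vert[of "exit_vert v p" "exit_vert w q"] that assms(2)
      by (simp add: exits_path)
  qed
  show ?thesis
  proof (cases "v = w")
    case True
    have "(\<Sum>p \<in> exits v. gen (Vert (exit_vert v p)) * gen (Vert (exit_vert w q)))
        \<approx>\<^bsub>EH\<^esub> gen (Vert (exit_vert w q))"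
      using True assms diff
      by (intro lpa_eq_sum_delta[where j = q] finite_exits) (auto simp: exits_path EH.lpa_vert_idem)
    with True show ?thesis by (simp add: exit_sum_def sum_distrib_right)
  next
    case False
    have "(\<Sum>p \<in> exits v. gen (Vert (exit_vert v p)) * gen (Vert (exit_vert w q))) \<approx>\<^bsub>EH\<^esub> 0"
      using False diff by (intro lpa_eq_sum_zero) auto
    with False show ?thesis by (simp add: exit_sum_def sum_distrib_right)
  qed
qed

lemma vert_exit_sum:
  assumes "exit_path E H v p"
  shows "gen (Vert (exit_vert v p)) * exit_sum v \<approx>\<^bsub>EH\<^esub> gen (Vert (exit_vert v p))"
proof -
  have "gen (Vert (exit_vert v p)) * gen (Vert (exit_vert v q)) \<approx>\<^bsub>EH\<^esub> 0"
    if "q \<in> exits v" "q \<noteq> p" for q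
  proof -
    have "exit_vert v p \<noteq> exit_vert v q"
      using exit_vert_inj[of v p v q] that assms by (auto simp: exits_path)
    then show ?thesis
      using EH.lpa_vert_vert[of "exit_vert v p" "exit_vert v q"] that assms
      by (simp add: exits_path)
  qed
  then show ?thesis
    unfolding exit_sum_def sum_distrib_left using assms exit_path_vert
    by (intro lpa_eq_sum_delta[where j = p] finite_exits) (auto simp: exits_path EH.lpa_vert_idem)
qed

text \<open>An element fixed by one summand of \<open>exit_sum v\<close> is fixed by the whole sum,
  the summands being orthogonal idempotents. This is how the image of a source or range absorbs each
  term of the image of an edge.\<close>

lemma exit_sum_left:
  assumes "exit_path E H v p" "gen (Vert (exit_vert v p)) * a \<approx>\<^bsub>EH\<^esub> a"
  shows "exit_sum v * a \<approx>\<^bsub>EH\<^esub> a"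
proof -
  have "exit_sum v * a \<approx>\<^bsub>EH\<^esub> exit_sum v * (gen (Vert (exit_vert v p)) * a)"
    using lpa_eq_sym[OF assms(2)] by (rule lpa_eq_left) simp
  also have "\<dots> = exit_sum v * gen (Vert (exit_vert v p)) * a" by (simp add: mult.assoc)
  also have "\<dots> \<approx>\<^bsub>EH\<^esub> gen (Vert (exit_vert v p)) * a"
    using exit_sum_vert[of v v p] assms lpa_eq_free(2)[OF assms(2)]
    by (intro lpa_eq_right) (auto simp: exit_path_vert)
  also note assms(2)
  finally show ?thesis .
qed

lemma exit_sum_right:
  assumes "exit_path E H v p" "a * gen (Vert (exit_vert v p)) \<approx>\<^bsub>EH\<^esub> a"
  shows "a * exit_sum v \<approx>\<^bsub>EH\<^esub> a"
proof -
  have "a * exit_sum v \<approx>\<^bsub>EH\<^esub> a * gen (Vert (exit_vert v p)) * exit_sum v"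
    using lpa_eq_sym[OF assms(2)] by (rule lpa_eq_right) simp
  also have "\<dots> = a * (gen (Vert (exit_vert v p)) * exit_sum v)" by (simp add: mult.assoc)
  also have "\<dots> \<approx>\<^bsub>EH\<^esub> a * gen (Vert (exit_vert v p))"
    using vert_exit_sum[of v p] assms lpa_eq_free(2)[OF assms(2)] by (intro lpa_eq_left) auto
  also note assms(2)
  finally show ?thesis .
qed

lemma fold_gen_free:
  assumes "x \<in> lpa_gens E"
  shows "fold_gen x \<in> lpa_free EH"
  using assms
  by (cases x) (auto simp: exits_path intro!: lpa_free_intros exit_edge_free exit_ghost_free)

text \<open>Products of images become double sums whose middle factor is a ghost times an edge of
  E(H). That factor vanishes off the diagonal and is an absorbed vertex on it.\<close>

lemma fold_gen_relators:
  assumes "r \<in> lpa_relators E"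
  shows "(lift_gens fold_gen r :: ('v + 'e list, 'e + 'e list, 'k::field) lpa_poly)
    \<in> generated_ideal (lpa_gens EH) (lpa_relators EH)"
proof (rule lift_gens_lpa_relators[OF _ _ _ _ _ _ _ assms])
  let ?g = "fold_gen :: ('v, 'e) lpa_gen \<Rightarrow> ('v + 'e list, 'e + 'e list, 'k) lpa_poly"
  have ex: "exit_path E H (tail E e) (e # p)" "exit_path E H (head E e) p"
    if "p \<in> exits (head E e)" "e \<in> arcs E" "tail E e \<notin> H" for e p
    using that by (auto simp: exits_path)
  show "?g (Vert v) * ?g (Vert w) \<approx>\<^bsub>EH\<^esub> (if v = w then ?g (Vert w) else 0)"
    if "v \<in> verts E" "w \<in> verts E" for v w
  proof -
    have "?g (Vert v) * ?g (Vert w) = (\<Sum>q \<in> exits w. exit_sum v * gen (Vert (exit_vert w q)))"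
      by (simp only: fold_gen.simps exit_sum_def[of w] sum_distrib_left)
    also have "\<dots> \<approx>\<^bsub>EH\<^esub> (\<Sum>q \<in> exits w. if v = w then gen (Vert (exit_vert w q)) else 0)"
      using that by (intro lpa_eq_sum exit_sum_vert) (auto simp: exits_path)
    also have "\<dots> = (if v = w then ?g (Vert w) else 0)" by (simp add: exit_sum_def)
    finally show ?thesis .
  qed
  show "?g (Vert (tail E e)) * ?g (Edge e) \<approx>\<^bsub>EH\<^esub> ?g (Edge e)" if e: "e \<in> arcs E" for e
  proof (cases "tail E e \<in> H")
    case True
    then show ?thesis using e EH.lpa_tail_edge[of "Inl e"] by (simp add: exit_sum_H)
  next
    case False
    have "exit_sum (tail E e) * exit_edge (tail E e) (e # p) * exit_ghost (head E e) p
        \<approx>\<^bsub>EH\<^esub> exit_edge (tail E e) (e # p) * exit_ghost (head E e) p" if "p \<in> exits (head E e)" for p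
      using ex[OF that e False]
      by (intro lpa_eq_right exit_sum_left[where p = "e # p"] vert_exit_edge) auto
    then show ?thesis
      using False by (auto simp: sum_distrib_left mult.assoc intro!: lpa_eq_sum)
  qed
  show "?g (Ghost e) * ?g (Vert (tail E e)) \<approx>\<^bsub>EH\<^esub> ?g (Ghost e)" if e: "e \<in> arcs E" for e
  proof (cases "tail E e \<in> H")
    case True
    then show ?thesis using e EH.lpa_ghost_tail[of "Inl e"] by (simp add: exit_sum_H)
  next
    case False
    have "exit_edge (head E e) p * (exit_ghost (tail E e) (e # p) * exit_sum (tail E e))
        \<approx>\<^bsub>EH\<^esub> exit_edge (head E e) p * exit_ghost (tail E e) (e # p)" if "p \<in> exits (head E e)" for p
      using ex[OF that e False]
      by (intro lpa_eq_left exit_sum_right[where p = "e # p"] exit_ghost_vert) auto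
    then show ?thesis
      using False by (auto simp: sum_distrib_right mult.assoc intro!: lpa_eq_sum)
  qed
  show "?g (Edge e) * ?g (Vert (head E e)) \<approx>\<^bsub>EH\<^esub> ?g (Edge e)" if e: "e \<in> arcs E" for e
  proof (cases "tail E e \<in> H")
    case True
    then show ?thesis using e EH.lpa_edge_head[of "Inl e"] H_arc by (simp add: exit_sum_H)
  next
    case False
    have "exit_edge (tail E e) (e # p) * (exit_ghost (head E e) p * exit_sum (head E e))
        \<approx>\<^bsub>EH\<^esub> exit_edge (tail E e) (e # p) * exit_ghost (head E e) p" if "p \<in> exits (head E e)" for p
      using ex[OF that e False]
      by (intro lpa_eq_left exit_sum_right[where p = p] exit_ghost_vert) auto
    then show ?thesis
      using False by (auto simp: sum_distrib_right mult.assoc intro!: lpa_eq_sum)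
  qed
  show "?g (Vert (head E e)) * ?g (Ghost e) \<approx>\<^bsub>EH\<^esub> ?g (Ghost e)" if e: "e \<in> arcs E" for e
  proof (cases "tail E e \<in> H")
    case True
    then show ?thesis using e EH.lpa_head_ghost[of "Inl e"] H_arc by (simp add: exit_sum_H)
  next
    case False
    have "exit_sum (head E e) * exit_edge (head E e) p * exit_ghost (tail E e) (e # p)
        \<approx>\<^bsub>EH\<^esub> exit_edge (head E e) p * exit_ghost (tail E e) (e # p)" if "p \<in> exits (head E e)" for p
      using ex[OF that e False]
      by (intro lpa_eq_right exit_sum_left[where p = p] vert_exit_edge) auto
    then show ?thesis
      using False by (auto simp: sum_distrib_left mult.assoc intro!: lpa_eq_sum)
  qed
  show "?g (Ghost e) * ?g (Edge f) \<approx>\<^bsub>EH\<^esub> (if e = f then ?g (Vert (head E e)) else 0)"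
    if e: "e \<in> arcs E" and f: "f \<in> arcs E" for e f
  proof -
    consider "tail E e \<in> H" "tail E f \<in> H" | "tail E e \<in> H" "tail E f \<notin> H"
      | "tail E e \<notin> H" "tail E f \<in> H" | "tail E e \<notin> H" "tail E f \<notin> H" "e \<noteq> f"
      | "tail E e \<notin> H" "e = f" by blast
    then show ?thesis
    proof cases
      case 1
      then show ?thesis
        using EH.lpa_ghost_edge[of "Inl e" "Inl f"] e f H_arc
        by (cases "e = f") (simp_all add: exit_sum_H)
    next
      case 2
      \<comment> \<open>An edge \<open>Inl e\<close> and an edge \<open>Inr \<alpha>\<close> of E(H)
        are distinct, which kills the middle product.\<close>
      have "gen (Ghost (Inl e)) * exit_edge (tail E f) (f # p) * exit_ghost (head E f) p
          \<approx>\<^bsub>EH\<^esub> 0 * exit_ghost (head E f) p" if "p \<in> exits (head E f)" for p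
        using ex[OF that f] 2 e EH.lpa_ghost_edge_diff[of "Inl e" "Inr (f # p)"]
        by (intro lpa_eq_right) (auto simp: exit_edge_def entry_paths_Cons)
      then show ?thesis
        using 2 by (auto simp: sum_distrib_left mult.assoc intro!: lpa_eq_sum_zero)
    next
      case 3
      have "exit_edge (head E e) p * (exit_ghost (tail E e) (e # p) * gen (Edge (Inl f)))
          \<approx>\<^bsub>EH\<^esub> exit_edge (head E e) p * 0" if "p \<in> exits (head E e)" for p
        using ex[OF that e] 3 f EH.lpa_ghost_edge_diff[of "Inr (e # p)" "Inl f"]
        by (intro lpa_eq_left) (auto simp: exit_ghost_def entry_paths_Cons)
      then show ?thesis
        using 3 by (auto simp: sum_distrib_right mult.assoc intro!: lpa_eq_sum_zero)
    next
      case 4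
      \<comment> \<open>As e and f differ, so do \<open>e # p\<close> and \<open>f # q\<close> for
        all p and q: every term vanishes in the middle.\<close>
      have "exit_edge (head E e) p * (exit_ghost (tail E e) (e # p) * exit_edge (tail E f) (f # q))
            * exit_ghost (head E f) q \<approx>\<^bsub>EH\<^esub> exit_edge (head E e) p * 0 * exit_ghost (head E f) q"
        if "p \<in> exits (head E e)" "q \<in> exits (head E f)" for p q
        using ex[OF that(1) e] ex[OF that(2) f] 4
        by (intro lpa_eq_mid exit_ghost_edge_diff) auto
      then show ?thesis
        using 4 by (auto simp: sum_product mult.assoc intro!: lpa_eq_sum_zero)
    next
      case 5
      \<comment> \<open>On the diagonal the middle is the end vertex of p; it is absorbed, and p
        times its ghost is the vertex of p. The total is the image of r(e).\<close>
      have "?g (Ghost e) * ?g (Edge f) = (\<Sum>p \<in> exits (head E e). \<Sum>q \<in> exits (head E e).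
          exit_edge (head E e) p * (exit_ghost (tail E e) (e # p) * exit_edge (tail E e) (e # q))
            * exit_ghost (head E e) q)"
        using 5 by (simp add: sum_product mult.assoc)
      also have "\<dots> \<approx>\<^bsub>EH\<^esub> (\<Sum>p \<in> exits (head E e). gen (Vert (exit_vert (head E e) p)))"
      proof (rule lpa_eq_double_sum_delta)
        show "finite (exits (head E e))" using e by (simp add: finite_exits)
        fix p assume p: "p \<in> exits (head E e)"
        note ex = ex[OF p e 5(1)]
        have "exit_edge (head E e) p * (exit_ghost (tail E e) (e # p) * exit_edge (tail E e) (e # p))
            * exit_ghost (head E e) p
          \<approx>\<^bsub>EH\<^esub> exit_edge (head E e) p * gen (Vert (Inl (path_end E (tail E e) (e # p))))
            * exit_ghost (head E e) p"
          using ex by (intro lpa_eq_mid exit_ghost_edge_same) auto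
        also have "\<dots> \<approx>\<^bsub>EH\<^esub> exit_edge (head E e) p * exit_ghost (head E e) p"
          using ex exit_edge_end[of "head E e" p] by (intro lpa_eq_right) auto
        also have "\<dots> \<approx>\<^bsub>EH\<^esub> gen (Vert (exit_vert (head E e) p))"
          using ex by (intro exit_edge_ghost)
        finally show "exit_edge (head E e) p *
            (exit_ghost (tail E e) (e # p) * exit_edge (tail E e) (e # p)) * exit_ghost (head E e) p
            \<approx>\<^bsub>EH\<^esub> gen (Vert (exit_vert (head E e) p))" .
      next
        fix p q assume pq: "p \<in> exits (head E e)" "q \<in> exits (head E e)" "p \<noteq> q"
        have "exit_edge (head E e) p * (exit_ghost (tail E e) (e # p) * exit_edge (tail E e) (e # q))
            * exit_ghost (head E e) q \<approx>\<^bsub>EH\<^esub> exit_edge (head E e) p * 0 * exit_ghost (head E e) q"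
          using ex[OF pq(1) e 5(1)] ex[OF pq(2) e 5(1)] pq
          by (intro lpa_eq_mid exit_ghost_edge_diff) auto
        then show "exit_edge (head E e) p * (exit_ghost (tail E e) (e # p) * exit_edge (tail E e) (e # q))
            * exit_ghost (head E e) q \<approx>\<^bsub>EH\<^esub> 0" by simp
      qed
      finally show ?thesis using 5 by (simp add: exit_sum_def)
    qed
  qed
  show "?g (Vert v) \<approx>\<^bsub>EH\<^esub> (\<Sum>e \<in> out_arcs E v. ?g (Edge e) * ?g (Ghost e))"
    if v: "regular_vertex E v" for v
  proof (cases "v \<in> H")
    case True
    then show ?thesis
      using v EH.lpa_regular[of "Inl v"]
      by (simp add: exit_sum_H regular_vertex_EH_Inl out_arcs_EH_Inl sum.reindex)
  next
    case False
    \<comment> \<open>For fixed e the diagonal terms are the edges \<open>e # p\<close> times their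
      own ghosts, that is, the vertices \<open>e # p\<close> of E(H).\<close>
    have "?g (Edge e) * ?g (Ghost e) \<approx>\<^bsub>EH\<^esub> (\<Sum>p \<in> exits (head E e). gen (Vert (exit_vert v (e # p))))"
      if "e \<in> out_arcs E v" for e
    proof -
      from that have e: "e \<in> arcs E" "tail E e = v" by auto
      note ex = ex[OF _ e(1), unfolded e(2), OF _ False]
      have "?g (Edge e) * ?g (Ghost e) = (\<Sum>p \<in> exits (head E e). \<Sum>q \<in> exits (head E e).
          exit_edge v (e # p) * (exit_ghost (head E e) p * exit_edge (head E e) q) * exit_ghost v (e # q))"
        using False e by (simp add: sum_product mult.assoc)
      also have "\<dots> \<approx>\<^bsub>EH\<^esub> (\<Sum>p \<in> exits (head E e). gen (Vert (exit_vert v (e # p))))"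
      proof (rule lpa_eq_double_sum_delta)
        show "finite (exits (head E e))" using e by (simp add: finite_exits)
        fix p assume p: "p \<in> exits (head E e)"
        note ex = ex[OF p]
        have "exit_edge v (e # p) * (exit_ghost (head E e) p * exit_edge (head E e) p) * exit_ghost v (e # p)
          \<approx>\<^bsub>EH\<^esub> exit_edge v (e # p) * gen (Vert (Inl (path_end E (head E e) p))) * exit_ghost v (e # p)"
          using ex by (intro lpa_eq_mid exit_ghost_edge_same) auto
        also have "\<dots> \<approx>\<^bsub>EH\<^esub> exit_edge v (e # p) * exit_ghost v (e # p)"
          using ex exit_edge_end[of v "e # p"] by (intro lpa_eq_right) auto
        also have "\<dots> \<approx>\<^bsub>EH\<^esub> gen (Vert (exit_vert v (e # p)))"
          using ex by (intro exit_edge_ghost)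
        finally show "exit_edge v (e # p) * (exit_ghost (head E e) p * exit_edge (head E e) p)
            * exit_ghost v (e # p) \<approx>\<^bsub>EH\<^esub> gen (Vert (exit_vert v (e # p)))" .
      next
        fix p q assume pq: "p \<in> exits (head E e)" "q \<in> exits (head E e)" "p \<noteq> q"
        have "exit_edge v (e # p) * (exit_ghost (head E e) p * exit_edge (head E e) q) * exit_ghost v (e # q)
          \<approx>\<^bsub>EH\<^esub> exit_edge v (e # p) * 0 * exit_ghost v (e # q)"
          using ex[OF pq(1)] ex[OF pq(2)] pq
          by (intro lpa_eq_mid exit_ghost_edge_diff) auto
        then show "exit_edge v (e # p) * (exit_ghost (head E e) p * exit_edge (head E e) q)
            * exit_ghost v (e # q) \<approx>\<^bsub>EH\<^esub> 0" by simp
      qed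
      finally show ?thesis .
    qed
    then have "(\<Sum>e \<in> out_arcs E v. ?g (Edge e) * ?g (Ghost e))
        \<approx>\<^bsub>EH\<^esub> (\<Sum>e \<in> out_arcs E v. \<Sum>p \<in> exits (head E e). gen (Vert (exit_vert v (e # p))))"
      by (rule lpa_eq_sum)
    also have "\<dots> = (\<Sum>e \<in> out_arcs E v. \<Sum>p \<in> (#) e ` exits (head E e). gen (Vert (exit_vert v p)))"
      by (simp add: sum.reindex)
    \<comment> \<open>The paths \<open>e # p\<close> with e running over the edges out of v exhaust
      F_v, each occurring once.\<close>
    also have "\<dots> = exit_sum v"
      unfolding exit_sum_def exits_notin_H[OF False]
      using v by (intro sum.UNION_disjoint[symmetric]) (auto simp: regular_vertex_def finite_exits)
    finally show ?thesis by (simp add: lpa_eq_sym)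
  qed
qed

section \<open>The two homomorphisms are inverse to each other\<close>

text \<open>Only a congruence, unlike the two lemmas after it: for the empty path it compares v with
  v v.\<close>

lemma lift_unfold_exit_vert:
  assumes "exit_path E H v p"
  shows "unfold_gen E (Vert (exit_vert v p)) \<approx>\<^bsub>E\<^esub> path_elt E v p * ghost_elt E v p"
proof (cases p)
  case Nil
  then show ?thesis
    using assms lpa_eq_sym[OF lpa_vert_idem[of v]] by (simp add: exit_vert_def H_subset)
next
  case (Cons e q)
  then show ?thesis
    using assms by (auto simp: exit_vert_def intro!: lpa_eq_refl lpa_free_intros)
qed

lemma lift_unfold_exit_edge:
  "exit_path E H v p \<Longrightarrow> lift_gens (unfold_gen E) (exit_edge v p) = path_elt E v p"
  by (cases p) (simp_all add: exit_edge_def)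

lemma lift_unfold_exit_ghost:
  "exit_path E H v p \<Longrightarrow> lift_gens (unfold_gen E) (exit_ghost v p) = ghost_elt E v p"
  by (cases p) (simp_all add: exit_ghost_def)

text \<open>After unfolding, the sums are the decompositions of v or of r(e) from
  \<open>sum_path_ghost\<close>; for an edge this leaves e r(e) = e.\<close>

lemma unfold_fold:
  assumes "x \<in> lpa_gens E"
  shows "lift_gens (unfold_gen E) (fold_gen x) \<approx>\<^bsub>E\<^esub> gen x"
proof (cases x)
  case (Vert v)
  with assms have v: "v \<in> verts E" by simp
  have "lift_gens (unfold_gen E) (exit_sum v)
      \<approx>\<^bsub>E\<^esub> (\<Sum>p \<in> exits v. path_elt E v p * ghost_elt E v p)"
    unfolding exit_sum_def lift_gens_sum lift_gens_gen
    by (intro lpa_eq_sum lift_unfold_exit_vert) (simp add: exits_path)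
  also have "\<dots> \<approx>\<^bsub>E\<^esub> gen (Vert v)" using v by (rule sum_path_ghost)
  finally show ?thesis using Vert by simp
next
  case (Edge e)
  with assms have e: "e \<in> arcs E" by simp
  show ?thesis
  proof (cases "tail E e \<in> H")
    case True
    then show ?thesis using Edge e by (simp add: lpa_eq_refl free_algebra_gen)
  next
    case False
    have "lift_gens (unfold_gen E) (fold_gen (Edge e))
        = gen (Edge e) * (\<Sum>p \<in> exits (head E e). path_elt E (head E e) p * ghost_elt E (head E e) p)"
      using False e by (simp add: lift_gens_sum lift_gens_mult lift_unfold_exit_edge
          lift_unfold_exit_ghost exits_path sum_distrib_left mult.assoc)
    also have "\<dots> \<approx>\<^bsub>E\<^esub> gen (Edge e) * gen (Vert (head E e))"
      using e by (intro lpa_eq_left sum_path_ghost free_algebra_gen) auto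
    also have "\<dots> \<approx>\<^bsub>E\<^esub> gen (Edge e)" using e by (rule lpa_edge_head)
    finally show ?thesis using Edge by simp
  qed
next
  case (Ghost e)
  with assms have e: "e \<in> arcs E" by simp
  show ?thesis
  proof (cases "tail E e \<in> H")
    case True
    then show ?thesis using Ghost e by (simp add: lpa_eq_refl free_algebra_gen)
  next
    case False
    have "lift_gens (unfold_gen E) (fold_gen (Ghost e))
        = (\<Sum>p \<in> exits (head E e). path_elt E (head E e) p * ghost_elt E (head E e) p) * gen (Ghost e)"
      using False e by (simp add: lift_gens_sum lift_gens_mult lift_unfold_exit_edge
          lift_unfold_exit_ghost exits_path sum_distrib_right mult.assoc)
    also have "\<dots> \<approx>\<^bsub>E\<^esub> gen (Vert (head E e)) * gen (Ghost e)"
      using e by (intro lpa_eq_right sum_path_ghost free_algebra_gen) auto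
    also have "\<dots> \<approx>\<^bsub>E\<^esub> gen (Ghost e)" using e by (rule lpa_head_ghost)
    finally show ?thesis using Ghost by simp
  qed
qed

text \<open>By induction the remaining path p returns as its edge of E(H). In the sum for the first
  edge e, the ghost of q meets the edge of p, so only q = p survives and leaves the edge
  \<open>e # p\<close>.\<close>

lemma lift_fold_path_elt:
  "exit_path E H v p \<Longrightarrow> lift_gens fold_gen (path_elt E v p)
     \<approx>\<^bsub>EH\<^esub> (exit_edge v p :: ('v + 'e list, 'e + 'e list, 'k::field) lpa_poly)"
proof (induction p arbitrary: v)
  case Nil
  then show ?case by (simp add: exit_sum_H exit_edge_def lpa_eq_refl free_algebra_gen)
next
  case (Cons e p)
  let ?w = "head E e"
  from Cons.prems have e: "e \<in> arcs E" "tail E e = v" "v \<notin> H" and p: "exit_path E H ?w p" by auto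
  have ex: "exit_path E H v (e # q)" if "q \<in> exits ?w" for q
    using that e by (simp add: exits_path)
  have T: "fold_gen (Edge e) \<in> lpa_free EH" using e by (intro fold_gen_free) simp
  have "lift_gens fold_gen (path_elt E v (e # p))
      = fold_gen (Edge e) * (lift_gens fold_gen (path_elt E ?w p)
          :: ('v + 'e list, 'e + 'e list, 'k) lpa_poly)"
    by (simp add: lift_gens_mult)
  also have "\<dots> \<approx>\<^bsub>EH\<^esub> fold_gen (Edge e) * exit_edge ?w p"
    using T Cons.IH[OF p] by (intro lpa_eq_left)
  also have "\<dots> = (\<Sum>q \<in> exits ?w. exit_edge v (e # q) * (exit_ghost ?w q * exit_edge ?w p))"
    using e by (simp add: sum_distrib_right mult.assoc)
  also have "\<dots> \<approx>\<^bsub>EH\<^esub> exit_edge v (e # p)"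
  proof (rule lpa_eq_sum_delta)
    show "finite (exits ?w)" "p \<in> exits ?w" using e p by (simp_all add: finite_exits exits_path)
    have "exit_edge v (e # p) * (exit_ghost ?w p * exit_edge ?w p)
        \<approx>\<^bsub>EH\<^esub> exit_edge v (e # p) * gen (Vert (Inl (path_end E v (e # p))))"
      using exit_ghost_edge_same[OF p] Cons.prems by (intro lpa_eq_left) auto
    also have "\<dots> \<approx>\<^bsub>EH\<^esub> exit_edge v (e # p)" using Cons.prems by (rule exit_edge_end)
    finally show "exit_edge v (e # p) * (exit_ghost ?w p * exit_edge ?w p) \<approx>\<^bsub>EH\<^esub> exit_edge v (e # p)" .
  next
    fix q assume q: "q \<in> exits ?w" "q \<noteq> p"
    then have "exit_edge v (e # q) * (exit_ghost ?w q * exit_edge ?w p) \<approx>\<^bsub>EH\<^esub> exit_edge v (e # q) * 0"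
      using p ex[OF q(1)] by (intro lpa_eq_left exit_ghost_edge_diff) (auto simp: exits_path)
    then show "exit_edge v (e # q) * (exit_ghost ?w q * exit_edge ?w p) \<approx>\<^bsub>EH\<^esub> 0" by simp
  qed
  finally show ?case .
qed

lemma lift_fold_ghost_elt:
  "exit_path E H v p \<Longrightarrow> lift_gens fold_gen (ghost_elt E v p)
     \<approx>\<^bsub>EH\<^esub> (exit_ghost v p :: ('v + 'e list, 'e + 'e list, 'k::field) lpa_poly)"
proof (induction p arbitrary: v)
  case Nil
  then show ?case by (simp add: exit_sum_H exit_ghost_def lpa_eq_refl free_algebra_gen)
next
  case (Cons e p)
  let ?w = "head E e"
  from Cons.prems have e: "e \<in> arcs E" "tail E e = v" "v \<notin> H" and p: "exit_path E H ?w p" by auto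
  have ex: "exit_path E H v (e # q)" if "q \<in> exits ?w" for q
    using that e by (simp add: exits_path)
  have T: "fold_gen (Ghost e) \<in> lpa_free EH" using e by (intro fold_gen_free) simp
  have "lift_gens fold_gen (ghost_elt E v (e # p))
      = (lift_gens fold_gen (ghost_elt E ?w p)
          :: ('v + 'e list, 'e + 'e list, 'k) lpa_poly) * fold_gen (Ghost e)"
    by (simp add: lift_gens_mult)
  also have "\<dots> \<approx>\<^bsub>EH\<^esub> exit_ghost ?w p * fold_gen (Ghost e)"
    using T Cons.IH[OF p] by (intro lpa_eq_right)
  also have "\<dots> = (\<Sum>q \<in> exits ?w. exit_ghost ?w p * exit_edge ?w q * exit_ghost v (e # q))"
    using e by (simp add: sum_distrib_left mult.assoc)
  also have "\<dots> \<approx>\<^bsub>EH\<^esub> exit_ghost v (e # p)"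
  proof (rule lpa_eq_sum_delta)
    show "finite (exits ?w)" "p \<in> exits ?w" using e p by (simp_all add: finite_exits exits_path)
    have "exit_ghost ?w p * exit_edge ?w p * exit_ghost v (e # p)
        \<approx>\<^bsub>EH\<^esub> gen (Vert (Inl (path_end E v (e # p)))) * exit_ghost v (e # p)"
      using exit_ghost_edge_same[OF p] Cons.prems by (intro lpa_eq_right) auto
    also have "\<dots> \<approx>\<^bsub>EH\<^esub> exit_ghost v (e # p)" using Cons.prems by (rule end_exit_ghost)
    finally show "exit_ghost ?w p * exit_edge ?w p * exit_ghost v (e # p) \<approx>\<^bsub>EH\<^esub> exit_ghost v (e # p)" .
  next
    fix q assume q: "q \<in> exits ?w" "q \<noteq> p"
    then have "exit_ghost ?w p * exit_edge ?w q * exit_ghost v (e # q) \<approx>\<^bsub>EH\<^esub> 0 * exit_ghost v (e # q)"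
      using p ex[OF q(1)] by (intro lpa_eq_right exit_ghost_edge_diff) (auto simp: exits_path)
    then show "exit_ghost ?w p * exit_edge ?w q * exit_ghost v (e # q) \<approx>\<^bsub>EH\<^esub> 0" by simp
  qed
  finally show ?case .
qed

text \<open>The vertex \<alpha> goes to \<alpha>\<alpha>^* and comes back as its edge times its
  ghost, which relation (4) in E(H) turns into the vertex again.\<close>

lemma fold_unfold:
  assumes "x \<in> lpa_gens EH"
  shows "lift_gens fold_gen (unfold_gen E x)
    \<approx>\<^bsub>EH\<^esub> (gen x :: ('v + 'e list, 'e + 'e list, 'k::field) lpa_poly)"
proof -
  have inr: ?thesis if "\<alpha> \<in> entry_paths E H" "x = Vert (Inr \<alpha>) \<or> x = Edge (Inr \<alpha>) \<or> x = Ghost (Inr \<alpha>)"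
    for \<alpha>
  proof -
    let ?v = "tail E (hd \<alpha>)"
    note ex = entry_path_exit[OF that(1)]
    have "\<alpha> \<noteq> []" using that(1) by auto
    then have eq: "exit_edge ?v \<alpha> = gen (Edge (Inr \<alpha>))" "exit_ghost ?v \<alpha> = gen (Ghost (Inr \<alpha>))"
      "exit_vert ?v \<alpha> = Inr \<alpha>"
      by (simp_all add: exit_edge_def exit_ghost_def exit_vert_def)
    note edge = lift_fold_path_elt[OF ex] and ghost = lift_fold_ghost_elt[OF ex]
    have "lift_gens fold_gen (path_elt E ?v \<alpha>) * lift_gens fold_gen (ghost_elt E ?v \<alpha>)
        \<approx>\<^bsub>EH\<^esub> exit_edge ?v \<alpha> * (exit_ghost ?v \<alpha> :: ('v + 'e list, 'e + 'e list, 'k) lpa_poly)"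
      using edge ghost by (rule lpa_eq_mult)
    also have "\<dots> \<approx>\<^bsub>EH\<^esub> gen (Vert (exit_vert ?v \<alpha>))" using ex by (rule exit_edge_ghost)
    finally show ?thesis
      using that(2) edge ghost by (auto simp: lift_gens_mult eq)
  qed
  show ?thesis
    using assms inr
    by (cases x; cases "(E, x)" rule: unfold_gen.cases)
      (auto simp: exit_sum_H lpa_eq_refl free_algebra_gen)
qed

theorem isomorphic_leavitt_path_algebras:
  "isomorphic_algebras
    (leavitt_path_algebra E :: ('k::field, ('v, 'e, 'k) lpa_poly set) algebra_struct)
    (leavitt_path_algebra EH)"
  unfolding leavitt_path_algebra_def
  by (rule isomorphic_presented_algebras[where h = fold_gen and k = "unfold_gen E"])
    (simp_all add: fold_gen_free unfold_gen_free fold_gen_relators unfold_gen_relators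
      unfold_fold[unfolded lpa_eq_def] fold_unfold[unfolded lpa_eq_def])

end

theorem lemma3p7:
  fixes E :: "('v, 'e) pre_digraph" and H :: "'v set"
  assumes "wf_digraph E"
    and "row_finite E"
    and "hereditary E H"
    and "fin_digraph (complement_graph E H)"
    and "acyclic_graph (complement_graph E H)"
    and "\<forall>v \<in> verts E - H. connects_set E v H"
    and "finite {e \<in> arcs E. tail E e \<in> verts E - H \<and> head E e \<in> H}"
  shows "isomorphic_algebras
    (leavitt_path_algebra E :: ('k::field, (('v, 'e) lpa_gen, 'k) free_poly set) algebra_struct)
    (leavitt_path_algebra (hereditary_graph E H))"
proof -
  interpret hereditary_lpa E H
    using assms(1-6) by (intro hereditary_lpa.intro hereditary_lpa_axioms.intro)
  show ?thesis by (rule isomorphic_leavitt_path_algebras)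
qed

end
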